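(* There exists a uniform (absolute) constant $C>0$ such that the following holds. Let $h\colon \mathbb{R} \to \mathbb{R}$ be an increasing homeomorphism and $A\in BMO(\mathbb{H})$. (1) If $\rho_h\leq \widehat{A}$ in $\mathbb{H}$, then $K_h \leq C\widehat{A} +C\|A\|_*$ in $\mathbb{H}$. (2) If $K_h\leq \widehat{A}$ in $\mathbb{H}$, then $\rho_h \leq 4\widehat{A}$ in $\mathbb{H}$. The same conclusions hold with $\check{A}$ in place of $\widehat{A}$: if $\rho_h\le \check{A}$ in $\mathbb{H}$, then $K_h\le C\check{A}+C\|A\|_*$ in $\mathbb{H}$; and if $K_h\le\check{A}$ in $\mathbb{H}$, then $\rho_h\le 4\check{A}$ in $\mathbb{H}$. In particular, under any of these conditions ($\rho_h\le\widehat{A}$, $K_h\le\widehat{A}$, $\rho_h\le\check{A}$, or $K_h\le\check{A}$ in $\mathbb{H}$), the Beurling--Ahlfors extension of $h$ to the upper half-plane is $BMO$-quasiconformal.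
   Context: $\mathbb{H}=\{(x,y)\in\mathbb{R}^2:y>0\}$ is the upper half-plane; $|\cdot|$ applied to sets is Lebesgue measure. For an increasing homeomorphism $h\colon\mathbb{R}\to\mathbb{R}$, $x\in\mathbb{R}$, $t>0$, the symmetric distortion function is $$\rho_h(x,t)= \max \left\{ \frac{|h(x+t)-h(x)|}{|h(x)-h(x-t)|}, \frac{|h(x)-h(x-t)|}{|h(x+t)-h(x)|}\right\}.$$ The Beurling--Ahlfors extension of $h$ is the map $H\colon\overline{\mathbb{H}}\to\overline{\mathbb{H}}$ (where $\overline{\mathbb H}=\mathbb H\cup\mathbb R$) with $H|_{\mathbb{R}}=h$ and $H(x,y)=u(x,y)+iv(x,y)$ for $x\in\mathbb{R}$, $y>0$, where $$u(x,y)=\frac{1}{2y}\int_{x-y}^{x+y} h(t)\,dt,\qquad v(x,y)=\frac{1}{2y}\left( \int_{x}^{x+y} h(t)\,dt - \int_{x-y}^{x} h(t)\,dt\right).$$ It is a homeomorphism of $\overline{\mathbb{H}}$ and a $C^1$-diffeomorphism of $\mathbb{H}$. For a homeomorphism $H$ between planar open sets, $K_H(x,y)=\inf\{K\ge1: \|DH(x,y)\|^2\le K J_H(x,y)\}$ is the quasiconformal dilatation, where $\|DH\|$ is the operator norm of the differential matrix and $J_H$ the Jacobian determinant; $K_h$ denotes the quasiconformal dilatation in $\mathbb{H}$ of the Beurling--Ahlfors extension of $h$. For an open set $U\subset\mathbb{R}^n$, a function $A\in L^1_{\mathrm{loc}}(U)$ lies in $BMO(U)$ if $$\|A\|_*=\sup_{B\subset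 U}\frac{1}{|B|}\int_B|A-A_B|<\infty,\qquad A_B=\frac{1}{|B|}\int_B A,$$ where the supremum is over all closed balls $B\subset U$. For $A\in L^1_{\mathrm{loc}}(\mathbb{H})$ and $z=(x,y)\in\mathbb{H}$, $$\widehat{A}(z)=\frac{1}{|B_z|}\int_{B_z}A,\quad B_z=B(z,y/2),\qquad \check{A}(z)=\frac{1}{|Q_z|}\int_{Q_z}A=\frac{1}{2y^2}\int_{y/2}^{3y/2}\int_{x-y}^{x+y}A,$$ where $Q_z$ is the $2y\times y$ open rectangle centered at $z$. A homeomorphism $H\colon U\to V$ between open sets $U,V\subset\mathbb{R}^2$ is a mapping of finite distortion if it is orientation-preserving, $H\in W^{1,1}_{\mathrm{loc}}(U)$, $J_H\in L^1_{\mathrm{loc}}(U)$, and $K_H<\infty$ a.e. It is $BMO$-quasiconformal if it is a mapping of finite distortion and there exists $Q\in BMO(U)$ such that $K_H\le Q$ a.e. in $U$. *)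

theory Defs
  imports "HOL-Complex_Analysis.Complex_Analysis"
begin

text \<open>The plane is identified with the complex numbers, \<open>(x, y)\<close> being \<open>Complex x y\<close>.\<close>

definition upper_half_plane :: "complex set" where
  "upper_half_plane = {z. 0 < Im z}"

definition L1_loc :: "'a::euclidean_space set \<Rightarrow> ('a \<Rightarrow> 'b::euclidean_space) \<Rightarrow> bool" where
  "L1_loc U f \<longleftrightarrow> (\<forall>S. compact S \<and> S \<subseteq> U \<longrightarrow> set_integrable lebesgue S f)"

definition avg :: "'a::euclidean_space set \<Rightarrow> ('a \<Rightarrow> real) \<Rightarrow> real" where
  "avg S f = (1 / measure lebesgue S) * (LINT w:S|lebesgue. f w)"


subsection \<open>Bounded mean oscillation\<close>

definition mean_osc :: "'a::euclidean_space set \<Rightarrow> ('a \<Rightarrow> real) \<Rightarrow> real" where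
  "mean_osc B A = avg B (\<lambda>w. \<bar>A w - avg B A\<bar>)"

definition balls_in :: "'a::euclidean_space set \<Rightarrow> 'a set set" where
  "balls_in U = {cball c r |c r. 0 < r \<and> cball c r \<subseteq> U}"

definition BMO :: "'a::euclidean_space set \<Rightarrow> ('a \<Rightarrow> real) set" where
  "BMO U = {A. L1_loc U A \<and> bdd_above ((\<lambda>B. mean_osc B A) ` balls_in U)}"

text \<open>The supremum is taken in the reals, so it is meaningful only for \<open>A \<in> BMO U\<close> with \<open>U\<close> open
  and nonempty.\<close>
definition BMO_norm :: "'a::euclidean_space set \<Rightarrow> ('a \<Rightarrow> real) \<Rightarrow> real" where
  "BMO_norm U A = (SUP B\<in>balls_in U. mean_osc B A)"

definition avg_hat :: "(complex \<Rightarrow> real) \<Rightarrow> complex \<Rightarrow> real" where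
  "avg_hat A z = avg (ball z (Im z / 2)) A"

definition avg_check :: "(complex \<Rightarrow> real) \<Rightarrow> complex \<Rightarrow> real" where
  "avg_check A z =
     avg (box (Complex (Re z - Im z) (Im z / 2)) (Complex (Re z + Im z) (3 * Im z / 2))) A"


subsection \<open>Increasing homeomorphisms of the line and the Beurling--Ahlfors extension\<close>

definition increasing_homeo :: "(real \<Rightarrow> real) \<Rightarrow> bool" where
  "increasing_homeo h \<longleftrightarrow> strict_mono h \<and> (\<exists>g. homeomorphism UNIV UNIV h g)"

definition sym_distortion :: "(real \<Rightarrow> real) \<Rightarrow> real \<Rightarrow> real \<Rightarrow> real" where
  "sym_distortion h x t =
     max (\<bar>h (x + t) - h x\<bar> / \<bar>h x - h (x - t)\<bar>) (\<bar>h x - h (x - t)\<bar> / \<bar>h (x + t) - h x\<bar>)"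

definition BA_u :: "(real \<Rightarrow> real) \<Rightarrow> real \<Rightarrow> real \<Rightarrow> real" where
  "BA_u h x y = 1 / (2 * y) * integral {x - y..x + y} h"

definition BA_v :: "(real \<Rightarrow> real) \<Rightarrow> real \<Rightarrow> real \<Rightarrow> real" where
  "BA_v h x y = 1 / (2 * y) * (integral {x..x + y} h - integral {x - y..x} h)"

text \<open>Only the values on the closed upper half-plane are relevant.\<close>
definition BA_extension :: "(real \<Rightarrow> real) \<Rightarrow> complex \<Rightarrow> complex" where
  "BA_extension h z =
     (if 0 < Im z then Complex (BA_u h (Re z) (Im z)) (BA_v h (Re z) (Im z))
      else complex_of_real (h (Re z)))"


subsection \<open>Quasiconformal dilatation\<close>

text \<open>Determinant of the real \<open>2 \<times> 2\<close> matrix of a real-linear map, whose columns are the images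
  of \<open>1\<close> and \<open>\<i>\<close>.\<close>
definition det_lin :: "(complex \<Rightarrow> complex) \<Rightarrow> real" where
  "det_lin L = Re (L 1) * Im (L \<i>) - Re (L \<i>) * Im (L 1)"

text \<open>Extended-real valued, so that the infimum of the empty set is \<open>\<infinity>\<close>.\<close>
definition dilatation :: "(complex \<Rightarrow> complex) \<Rightarrow> ereal" where
  "dilatation L = Inf (ereal ` {K. 1 \<le> K \<and> (onorm L)\<^sup>2 \<le> K * det_lin L})"

definition BA_dilatation :: "(real \<Rightarrow> real) \<Rightarrow> complex \<Rightarrow> ereal" where
  "BA_dilatation h z = dilatation (frechet_derivative (BA_extension h) (at z))"


subsection \<open>Weak differentials\<close>

primrec C_k :: "nat \<Rightarrow> ('a::euclidean_space \<Rightarrow> real) \<Rightarrow> bool" where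
  "C_k 0 f \<longleftrightarrow> continuous_on UNIV f"
| "C_k (Suc k) f \<longleftrightarrow>
     f differentiable_on UNIV \<and> (\<forall>b\<in>Basis. C_k k (\<lambda>x. frechet_derivative f (at x) b))"

definition test_function :: "'a::euclidean_space set \<Rightarrow> ('a \<Rightarrow> real) \<Rightarrow> bool" where
  "test_function U \<phi> \<longleftrightarrow>
     (\<forall>k. C_k k \<phi>) \<and> compact (closure {x. \<phi> x \<noteq> 0}) \<and> closure {x. \<phi> x \<noteq> 0} \<subseteq> U"

text \<open>\<open>H\<close> lies in \<open>W\<^sup>1\<^sup>,\<^sup>1\<^sub>l\<^sub>o\<^sub>c(U)\<close> and \<open>D z\<close> is, as a linear map, its weak differential at \<open>z\<close>; thus
  \<open>D\<close> is determined by \<open>H\<close> up to null sets.\<close>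
definition W11_loc :: "'a::euclidean_space set \<Rightarrow> ('a \<Rightarrow> 'b::euclidean_space) \<Rightarrow>
    ('a \<Rightarrow> 'a \<Rightarrow> 'b) \<Rightarrow> bool" where
  "W11_loc U H D \<longleftrightarrow>
     L1_loc U H \<and> (\<forall>z\<in>U. linear (D z)) \<and>
     (\<forall>b\<in>Basis. L1_loc U (\<lambda>z. D z b) \<and>
        (\<forall>\<phi>. test_function U \<phi> \<longrightarrow>
           (LINT z:U|lebesgue. frechet_derivative \<phi> (at z) b *\<^sub>R H z) =
           - (LINT z:U|lebesgue. \<phi> z *\<^sub>R D z b)))"


subsection \<open>Mappings of finite distortion\<close>

text \<open>A planar homeomorphism preserves orientation iff its local degree is \<open>1\<close> everywhere, i.e.
  the image of each positively oriented circle bounding a disc in \<open>U\<close> winds once, positively,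
  around the image of its centre.\<close>
definition orientation_preserving :: "complex set \<Rightarrow> (complex \<Rightarrow> complex) \<Rightarrow> bool" where
  "orientation_preserving U H \<longleftrightarrow>
     (\<forall>a r. 0 < r \<and> cball a r \<subseteq> U \<longrightarrow> winding_number (H \<circ> circlepath a r) (H a) = 1)"

definition finite_distortion :: "complex set \<Rightarrow> complex set \<Rightarrow> (complex \<Rightarrow> complex) \<Rightarrow>
    (complex \<Rightarrow> complex \<Rightarrow> complex) \<Rightarrow> bool" where
  "finite_distortion U V H D \<longleftrightarrow>
     open U \<and> open V \<and> (\<exists>G. homeomorphism U V H G) \<and> orientation_preserving U H \<and>
     W11_loc U H D \<and> L1_loc U (\<lambda>z. det_lin (D z)) \<and>
     (AE z in lebesgue_on U. dilatation (D z) < \<infinity>)"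

definition BMO_quasiconformal :: "complex set \<Rightarrow> complex set \<Rightarrow> (complex \<Rightarrow> complex) \<Rightarrow> bool" where
  "BMO_quasiconformal U V H \<longleftrightarrow>
     (\<exists>D. finite_distortion U V H D \<and>
        (\<exists>Q\<in>BMO U. AE z in lebesgue_on U. dilatation (D z) \<le> ereal (Q z)))"

end

theory Submission
  imports Defs
begin

text \<open>The differential of the extension is described by four numbers. For an increasing homeomorphism \<open>h\<close>
and \<open>z = (x, y)\<close> let \<open>R\<close> and \<open>L\<close> be the increments of \<open>h\<close> over \<open>[x, x + y]\<close> and \<open>[x - y, x]\<close>, and let \<open>p\<close> and \<open>m\<close> be the
gaps between the mean of \<open>h\<close> over either interval and its value at the outer end point, so that
\<open>0 < p < R\<close> and \<open>0 < m < L\<close>. The distortion of \<open>h\<close> at \<open>z\<close> is \<open>max (R / L) (L / R)\<close>; up to the common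
factor \<open>1 / (2 * y)\<close> the differential of the extension has the columns \<open>(R + L, R - L)\<close> and
\<open>(p - m, p + m)\<close>, and, up to the square of this factor, its determinant is
\<open>2 * (R * m + L * p)\<close> (\<open>has_derivative_BA_extension\<close>, \<open>det_BA_differential\<close>).

Distortion by dilatation: the first column has squared norm \<open>2 * (R\<^sup>2 + L\<^sup>2)\<close>, whereas the determinant is
at most \<open>4 * R * L\<close>; hence the distortion is at most twice the dilatation
(\<open>sym_distortion_le_dilatation\<close>).

Dilatation by distortion: the dilatation is at most \<open>2 * (R\<^sup>2 + L\<^sup>2) / (R * m + L * p)\<close>. Suppose \<open>L \<le> R\<close>,
and let \<open>r\<close> be the increment of \<open>h\<close> over \<open>[x, x + y / 4]\<close>. If \<open>r < R / 2\<close>, much of the right increment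
happens away from \<open>x\<close>, so \<open>p\<close> is comparable to \<open>R\<close> and the bound is a multiple of \<open>R / L\<close>. Otherwise the
interval of length \<open>y / 2\<close> to the right of \<open>x - y / 4\<close> carries an increment of at least \<open>R / 2\<close>; the
distortion at \<open>(x - y / 4, y / 2)\<close> carries it over to the interval on the left of \<open>x - y / 4\<close>, which bounds
\<open>m\<close> from below by \<open>R\<close> divided by a multiple of that distortion. In both cases the dilatation at \<open>z\<close> is at
most 32 times the distortion at \<open>z\<close> or at a point of bounded hyperbolic distance from \<open>z\<close>
(\<open>dilatation_le_sym_distortion\<close>). Using distortions at two places linearly, instead of iterating them,
is what makes the bound linear.

The function \<open>A\<close> enters only through averages over cells: discs and rectangles that are affine images
\<open>x + y * S\<close> of a fixed convex shape. Cells of hyperbolically close points lie in one ball inside the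
half-plane of comparable area, so their averages differ by a multiple of the BMO norm
(\<open>cell_avg_slow\<close>). This replaces the distortion at the nearby point by the average at \<open>z\<close>. The same
estimate shows that the averages are again a BMO function: along vertical chains they grow at most
logarithmically towards the real line, and a logarithm is integrable (\<open>BMO_slowly_varying\<close>).
The averages, or an affine function of them, are therefore the required majorant of the dilatation.

It remains to see that the extension is a mapping of finite distortion. The sum and difference of its
components are the means of \<open>h\<close> over \<open>[x, x + y]\<close> and \<open>[x - y, x]\<close>, and a mean increases with either end
point. For two points \<open>z\<close> and \<open>w\<close> one of the two intervals has moved monotonically, so the increment of
the extension from \<open>z\<close> to \<open>w\<close> is neither zero nor opposite to \<open>w - z\<close> (\<open>segment_homotopy_nonzero\<close>). This gives
injectivity, and a straight-line homotopy from the extension to the identity gives local degree 1.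
Surjectivity is the intermediate value theorem, applied twice. A continuously differentiable map has its
differential as weak differential, because the integral of a directional derivative of a compactly
supported function vanishes by translation invariance of Lebesgue measure.\<close>

section \<open>The differential of the Beurling--Ahlfors extension\<close>

text \<open>Means of \<open>h\<close> are difference quotients of a primitive \<open>F\<close> of \<open>h\<close>; the strict convexity of \<open>F\<close> then
carries all monotonicity properties.\<close>

locale homeo_primitive =
  fixes h F :: "real \<Rightarrow> real"
  assumes continuous: "continuous_on UNIV h"
    and mono: "strict_mono h"
    and surj: "surj h"
    and primitive: "(F has_real_derivative h x) (at x)"
begin

definition mean :: "real \<Rightarrow> real \<Rightarrow> real" where
  "mean s t = (F t - F s) / (t - s)"

lemma h_less: "s < t \<Longrightarrow> h s < h t"
  using mono by (rule strict_monoD)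

lemma primitive_bounds:
  assumes "s < t"
  shows "(t - s) * h s < F t - F s" "F t - F s < (t - s) * h t"
proof -
  obtain \<xi> where "s < \<xi>" "\<xi> < t" "F t - F s = (t - s) * h \<xi>"
    using MVT2[OF assms, of F h] primitive by blast
  then show "(t - s) * h s < F t - F s" "F t - F s < (t - s) * h t"
    using assms h_less by simp_all
qed

lemma mean_bounds:
  assumes "s < t"
  shows "h s < mean s t" "mean s t < h t"
  using primitive_bounds[OF assms] assms unfolding mean_def by (simp_all add: field_simps)

lemma mean_increases_right:
  assumes "s < t" "t < t'"
  shows "mean s t < mean s t'"
proof -
  have "F t' - F s > (t - s) * mean s t + (t' - t) * mean s t"
  proof -
    have "(t - s) * mean s t = F t - F s" using assms by (simp add: mean_def)
    moreover have "(t' - t) * mean s t \<le> (t' - t) * h t"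
      using mean_bounds(2)[OF assms(1)] assms by (intro mult_left_mono) auto
    ultimately show ?thesis using primitive_bounds(1)[OF assms(2)] by linarith
  qed
  then show ?thesis using assms by (simp add: mean_def[of s t'] field_simps)
qed

lemma mean_increases_left:
  assumes "s < s'" "s' < t"
  shows "mean s t < mean s' t"
proof -
  have "F t - F s < (t - s') * mean s' t + (s' - s) * mean s' t"
  proof -
    have "(t - s') * mean s' t = F t - F s'" using assms by (simp add: mean_def)
    moreover have "(s' - s) * h s' \<le> (s' - s) * mean s' t"
      using mean_bounds(1)[OF assms(2)] assms by (intro mult_left_mono) auto
    ultimately show ?thesis using primitive_bounds(2)[OF assms(1)] by linarith
  qed
  then show ?thesis using assms by (simp add: mean_def[of s t] field_simps)
qed

lemma mean_mono:
  assumes "s < t" "s' < t'" "s \<le> s'" "t \<le> t'"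
  shows "mean s t \<le> mean s' t'"
proof -
  have "mean s t \<le> mean s t'"
    using mean_increases_right[of s t t'] assms by (cases "t = t'") auto
  also have "\<dots> \<le> mean s' t'"
    using mean_increases_left[of s s' t'] assms by (cases "s = s'") auto
  finally show ?thesis .
qed

text \<open>The interval moves in two stages, first its right and then its left end point; the intermediate
interval \<open>[s, t']\<close> is nondegenerate in every case.\<close>

lemma mean_strict_mono:
  assumes "s < t" "s' < t'" "s \<le> s'" "t \<le> t'" "s \<noteq> s' \<or> t \<noteq> t'"
  shows "mean s t < mean s' t'"
proof (cases "s = s'")
  case True
  then show ?thesis using mean_increases_right[of s t t'] assms by auto
next
  case False
  have "mean s t \<le> mean s t'" using mean_mono assms by auto
  also have "\<dots> < mean s' t'" using mean_increases_left[of s s' t'] assms False by auto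
  finally show ?thesis .
qed

lemma integral_eq_primitive:
  assumes "a \<le> b"
  shows "integral {a..b} h = F b - F a"
proof -
  have "(h has_integral (F b - F a)) {a..b}"
    using assms primitive
    by (intro fundamental_theorem_of_calculus)
      (auto simp: has_real_derivative_iff_has_vector_derivative[symmetric]
        intro: has_field_derivative_at_within)
  then show ?thesis by (rule integral_unique)
qed

lemma BA_extension_primitive:
  assumes "0 < Im z"
  shows "BA_extension h z =
    Complex ((F (Re z + Im z) - F (Re z - Im z)) / (2 * Im z))
      ((F (Re z + Im z) - 2 * F (Re z) + F (Re z - Im z)) / (2 * Im z))"
  using assms by (simp add: BA_extension_def BA_u_def BA_v_def integral_eq_primitive field_simps)

lemma BA_extension_mean:
  assumes "0 < Im z"
  shows "Re (BA_extension h z) = (mean (Re z) (Re z + Im z) + mean (Re z - Im z) (Re z)) / 2"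
    "Im (BA_extension h z) = (mean (Re z) (Re z + Im z) - mean (Re z - Im z) (Re z)) / 2"
  using assms by (simp_all add: BA_extension_primitive mean_def field_simps)

definition right_incr :: "complex \<Rightarrow> real" where
  "right_incr z = h (Re z + Im z) - h (Re z)"

definition left_incr :: "complex \<Rightarrow> real" where
  "left_incr z = h (Re z) - h (Re z - Im z)"

definition right_gap :: "complex \<Rightarrow> real" where
  "right_gap z = h (Re z + Im z) - mean (Re z) (Re z + Im z)"

definition left_gap :: "complex \<Rightarrow> real" where
  "left_gap z = mean (Re z - Im z) (Re z) - h (Re z - Im z)"

text \<open>The columns of the differential are the images of \<open>1\<close> and \<open>\<i>\<close>; increments produce the first one and
gaps the second one.\<close>

definition BA_differential :: "complex \<Rightarrow> complex \<Rightarrow> complex" where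
  "BA_differential z w =
    Complex ((Re w * (right_incr z + left_incr z) + Im w * (right_gap z - left_gap z)) / (2 * Im z))
      ((Re w * (right_incr z - left_incr z) + Im w * (right_gap z + left_gap z)) / (2 * Im z))"

lemma incr_gap_bounds:
  assumes "0 < Im z"
  shows "0 < right_gap z" "right_gap z < right_incr z" "0 < left_gap z" "left_gap z < left_incr z"
    "0 < right_incr z" "0 < left_incr z"
  using assms mean_bounds[of "Re z" "Re z + Im z"] mean_bounds[of "Re z - Im z" "Re z"]
  by (auto simp: right_gap_def right_incr_def left_gap_def left_incr_def)

lemma has_derivative_BA_extension:
  assumes "0 < Im z"
  shows "(BA_extension h has_derivative BA_differential z) (at z)"
proof -
  let ?U = "\<lambda>z. (F (Re z + Im z) - F (Re z - Im z)) / (2 * Im z)"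
  let ?V = "\<lambda>z. (F (Re z + Im z) - 2 * F (Re z) + F (Re z - Im z)) / (2 * Im z)"
  have F: "((\<lambda>z. F (f z)) has_derivative (\<lambda>w. h (f z) * f' w)) (at z)"
    if "(f has_derivative f') (at z)" for f f'
    using has_derivative_compose[OF that, of F "\<lambda>x. h (f z) * x"] primitive
    by (simp add: has_field_derivative_def)
  have U: "(?U has_derivative (\<lambda>w. Re (BA_differential z w))) (at z)"
    using assms
    by (auto intro!: derivative_eq_intros F ext
        simp: BA_differential_def right_incr_def left_incr_def right_gap_def left_gap_def mean_def
          field_simps power2_eq_square)
  have V: "(?V has_derivative (\<lambda>w. Im (BA_differential z w))) (at z)"
    using assms
    by (auto intro!: derivative_eq_intros F ext
        simp: BA_differential_def right_incr_def left_incr_def right_gap_def left_gap_def mean_def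
          field_simps power2_eq_square)
  have "((\<lambda>z. complex_of_real (?U z) + \<i> * complex_of_real (?V z)) has_derivative
      (\<lambda>w. complex_of_real (Re (BA_differential z w)) + \<i> * complex_of_real (Im (BA_differential z w)))) (at z)"
    by (intro has_derivative_add has_derivative_mult_right has_derivative_of_real U V)
  then have "((\<lambda>z. Complex (?U z) (?V z)) has_derivative BA_differential z) (at z)"
    by (simp add: Complex_eq complex_eq[symmetric])
  moreover have "open {z. 0 < Im z}" by (simp add: open_halfspace_Im_gt)
  ultimately show ?thesis
    by (rule has_derivative_transform_within_open) (use assms in \<open>auto simp: BA_extension_primitive\<close>)
qed

lemma frechet_derivative_BA_extension:
  "0 < Im z \<Longrightarrow> frechet_derivative (BA_extension h) (at z) = BA_differential z"
  by (metis has_derivative_BA_extension frechet_derivative_at)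

lemma det_BA_differential:
  assumes "0 < Im z"
  shows "det_lin (BA_differential z) =
    2 * (right_incr z * left_gap z + left_incr z * right_gap z) / (2 * Im z)\<^sup>2"
  using assms by (simp add: det_lin_def BA_differential_def field_simps power2_eq_square)

lemma BA_differential_linear: "0 < Im z \<Longrightarrow> bounded_linear (BA_differential z)"
  using has_derivative_BA_extension has_derivative_bounded_linear by blast

end

lemma onorm_square_le:
  fixes L :: "complex \<Rightarrow> complex"
  assumes "linear L"
  shows "(onorm L)\<^sup>2 \<le> (norm (L 1))\<^sup>2 + (norm (L \<i>))\<^sup>2"
proof -
  let ?s = "sqrt ((norm (L 1))\<^sup>2 + (norm (L \<i>))\<^sup>2)"
  have "norm (L w) \<le> ?s * norm w" for w
  proof -
    have "w = Re w *\<^sub>R 1 + Im w *\<^sub>R \<i>" by (simp add: complex_eq_iff)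
    then have "L w = Re w *\<^sub>R L 1 + Im w *\<^sub>R L \<i>"
      by (metis assms linear_add linear_scale)
    then have "norm (L w) \<le> \<bar>Re w\<bar> * norm (L 1) + \<bar>Im w\<bar> * norm (L \<i>)"
      by (metis norm_triangle_ineq norm_scaleR)
    also have "\<dots> = (\<bar>Re w\<bar>, \<bar>Im w\<bar>) \<bullet> (norm (L 1), norm (L \<i>))"
      by simp
    also have "\<dots> \<le> norm (\<bar>Re w\<bar>, \<bar>Im w\<bar>) * norm (norm (L 1), norm (L \<i>))"
      by (rule norm_cauchy_schwarz)
    also have "\<dots> = ?s * norm w"
      by (simp add: norm_Pair cmod_def)
    finally show ?thesis .
  qed
  then have "onorm L \<le> ?s" by (rule onorm_le)
  moreover have "0 \<le> onorm L"
    using assms by (simp add: linear_conv_bounded_linear onorm_pos_le)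
  ultimately have "(onorm L)\<^sup>2 \<le> ?s\<^sup>2" by (rule power_mono)
  then show ?thesis by simp
qed

context homeo_primitive
begin

lemma sym_distortion_incr:
  assumes "0 < Im z"
  shows "sym_distortion h (Re z) (Im z) =
    max (right_incr z / left_incr z) (left_incr z / right_incr z)"
  using incr_gap_bounds(5,6)[OF assms]
  by (simp add: sym_distortion_def right_incr_def left_incr_def)

lemma sym_distortion_ge_1: "0 < Im z \<Longrightarrow> 1 \<le> sym_distortion h (Re z) (Im z)"
  using incr_gap_bounds(5,6)[of z] by (auto simp: sym_distortion_incr le_max_iff_disj)

lemma norms_BA_differential:
  assumes "0 < Im z"
  shows "(norm (BA_differential z 1))\<^sup>2 = 2 * ((right_incr z)\<^sup>2 + (left_incr z)\<^sup>2) / (2 * Im z)\<^sup>2"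
    "(norm (BA_differential z \<i>))\<^sup>2 = 2 * ((right_gap z)\<^sup>2 + (left_gap z)\<^sup>2) / (2 * Im z)\<^sup>2"
  using assms
  by (simp_all add: BA_differential_def cmod_power2 power_divide add_divide_distrib[symmetric])
    (simp_all add: power2_eq_square algebra_simps)

text \<open>Only the norm of the first column enters, together with \<open>p < R\<close> and \<open>m < L\<close> in the determinant.\<close>

lemma sym_distortion_le_dilatation:
  assumes "0 < Im z"
  shows "ereal (sym_distortion h (Re z) (Im z) / 2) \<le> BA_dilatation h z"
  unfolding BA_dilatation_def dilatation_def frechet_derivative_BA_extension[OF assms]
proof (rule Inf_greatest, clarsimp)
  fix K assume K: "1 \<le> K" "(onorm (BA_differential z))\<^sup>2 \<le> K * det_lin (BA_differential z)"
  note b = incr_gap_bounds[OF assms]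
  let ?R = "right_incr z" and ?L = "left_incr z"
  have "norm (BA_differential z 1) \<le> onorm (BA_differential z)"
    using onorm[OF BA_differential_linear[OF assms], of 1] by simp
  then have "(norm (BA_differential z 1))\<^sup>2 \<le> K * det_lin (BA_differential z)"
    using K by (meson norm_ge_zero order_trans power_mono)
  then have "2 * (?R\<^sup>2 + ?L\<^sup>2) \<le> K * (2 * (?R * left_gap z + ?L * right_gap z))"
    using assms by (simp add: norms_BA_differential det_BA_differential divide_le_cancel)
  also have "\<dots> \<le> K * (2 * (?R * ?L + ?L * ?R))"
    using b K(1) by (intro mult_left_mono add_mono) auto
  finally have *: "?R\<^sup>2 + ?L\<^sup>2 \<le> 2 * K * (?R * ?L)" by (simp add: algebra_simps)
  have "?R * ?R \<le> 2 * K * (?R * ?L)" "?L * ?L \<le> 2 * K * (?R * ?L)"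
    using * zero_le_square[of ?R] zero_le_square[of ?L] unfolding power2_eq_square
    by linarith+
  then have "?R * ?R \<le> (2 * K * ?L) * ?R" "?L * ?L \<le> (2 * K * ?R) * ?L"
    by (simp_all only: mult_ac)
  then have "?R \<le> 2 * K * ?L" "?L \<le> 2 * K * ?R"
    using b by (simp_all add: mult_le_cancel_right)
  then show "sym_distortion h (Re z) (Im z) \<le> K * 2"
    using b assms by (simp add: sym_distortion_incr field_simps)
qed

text \<open>The operator norm is at most the Hilbert--Schmidt norm, whose square is at most
\<open>4 * (R\<^sup>2 + L\<^sup>2)\<close> up to the factor \<open>1 / (2 * y)\<^sup>2\<close>.\<close>

lemma dilatation_le_quotient:
  assumes "0 < Im z" "2 * ((right_incr z)\<^sup>2 + (left_incr z)\<^sup>2) \<le>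
    K * (right_incr z * left_gap z + left_incr z * right_gap z)"
  shows "dilatation (BA_differential z) \<le> ereal K"
proof -
  note b = incr_gap_bounds[OF assms(1)]
  let ?R = "right_incr z" and ?L = "left_incr z" and ?p = "right_gap z" and ?m = "left_gap z"
  let ?q = "?R * ?m + ?L * ?p"
  have q: "0 < ?q" "?q \<le> ?R\<^sup>2 + ?L\<^sup>2"
  proof -
    show "0 < ?q" using b by (simp add: add_pos_pos)
    have "?q \<le> ?R * ?L + ?L * ?R" using b by (intro add_mono mult_left_mono) auto
    also have "\<dots> \<le> ?R\<^sup>2 + ?L\<^sup>2" using sum_squares_bound[of ?R ?L] by (simp add: mult_ac)
    finally show "?q \<le> ?R\<^sup>2 + ?L\<^sup>2" .
  qed
  have "?q \<le> 2 * (?R\<^sup>2 + ?L\<^sup>2)" by (rule order_trans[OF q(2)]) simp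
  also have "\<dots> \<le> K * ?q" by (rule assms(2))
  finally have "1 \<le> K" using q(1) by simp
  moreover have "(onorm (BA_differential z))\<^sup>2 \<le> K * det_lin (BA_differential z)"
  proof -
    have double: "2 * s + 2 * t \<le> K * (2 * q)" if "t \<le> s" "2 * s \<le> K * q" for s t q :: real
      using that by simp
    have "?p\<^sup>2 + ?m\<^sup>2 \<le> ?R\<^sup>2 + ?L\<^sup>2" using b by (auto intro!: add_mono power_mono)
    from double[OF this assms(2)] have "(2 * (?R\<^sup>2 + ?L\<^sup>2) + 2 * (?p\<^sup>2 + ?m\<^sup>2)) / (2 * Im z)\<^sup>2 \<le> K * (2 * ?q) / (2 * Im z)\<^sup>2"
      by (rule divide_right_mono) simp
    moreover have "(onorm (BA_differential z))\<^sup>2 \<le>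
        (2 * (?R\<^sup>2 + ?L\<^sup>2) + 2 * (?p\<^sup>2 + ?m\<^sup>2)) / (2 * Im z)\<^sup>2"
      using onorm_square_le[of "BA_differential z"] BA_differential_linear[OF assms(1)]
      by (simp add: norms_BA_differential[OF assms(1)] add_divide_distrib bounded_linear.linear)
    ultimately show ?thesis by (simp add: det_BA_differential[OF assms(1)])
  qed
  ultimately show ?thesis
    unfolding dilatation_def by (intro Inf_lower) auto
qed

lemma dilatation_finite: "0 < Im z \<Longrightarrow> dilatation (BA_differential z) < \<infinity>"
proof -
  assume z: "0 < Im z"
  let ?q = "right_incr z * left_gap z + left_incr z * right_gap z"
  have "0 < ?q" using incr_gap_bounds[OF z] by (simp add: add_pos_pos)
  then have "dilatation (BA_differential z) \<le>
      ereal (2 * ((right_incr z)\<^sup>2 + (left_incr z)\<^sup>2) / ?q)"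
    by (intro dilatation_le_quotient z) simp
  then show ?thesis by (auto simp: less_top[symmetric] top_ereal_def)
qed

end

text \<open>The case distinction on where the larger increment \<open>R\<close> is concentrated: \<open>r\<close> is its part next to the
common end point of the two intervals. A large \<open>r\<close> makes the gap \<open>m\<close> large, a small \<open>r\<close> the gap \<open>p\<close>.\<close>

lemma quotient_bound:
  fixes R L p m r \<rho> M :: real
  assumes "0 < L" "L \<le> R" "0 < p" "0 < m" "0 < M"
    and "R \<le> \<rho> * L" "R - r \<le> 4 * p" "r \<le> 4 * m * M"
  shows "2 * (R\<^sup>2 + L\<^sup>2) \<le> 32 * max \<rho> M * (R * m + L * p)"
proof -
  have LR: "L\<^sup>2 \<le> R\<^sup>2" using assms by (auto intro!: power_mono)
  show ?thesis
  proof (cases "R \<le> 2 * r")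
    case True
    have "R \<le> 8 * (m * M)" using True assms by simp
    then have "R * R \<le> 8 * (m * M) * R" using assms by (intro mult_right_mono) auto
    then have "2 * (R\<^sup>2 + L\<^sup>2) \<le> 32 * M * (R * m)"
      using LR by (simp add: power2_eq_square mult_ac)
    also have "\<dots> \<le> 32 * max \<rho> M * (R * m + L * p)"
      using assms by (intro mult_mono) auto
    finally show ?thesis .
  next
    case False
    have p: "R \<le> 8 * p" using False assms by simp
    have "0 < \<rho>" using assms by (smt (verit) mult_nonneg_nonneg mult_nonpos_nonneg)
    have "R * R \<le> (\<rho> * L) * (8 * p)" using assms p \<open>0 < \<rho>\<close> by (intro mult_mono) auto
    then have "2 * (R\<^sup>2 + L\<^sup>2) \<le> 32 * \<rho> * (L * p)"
      using LR by (simp add: power2_eq_square mult_ac)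
    also have "\<dots> \<le> 32 * max \<rho> M * (R * m + L * p)"
      using assms \<open>0 < \<rho>\<close> by (intro mult_mono) auto
    finally show ?thesis .
  qed
qed

context homeo_primitive
begin

text \<open>A gap is the mean of the distance of \<open>h\<close> from its value at the outer end point; a quarter of the interval
next to the inner end point already contributes this much.\<close>

lemma gap_lower_bounds:
  assumes "0 < Im z"
  shows "h (Re z + Im z) - h (Re z + Im z / 4) \<le> 4 * right_gap z"
    "h (Re z - Im z / 4) - h (Re z - Im z) \<le> 4 * left_gap z"
proof -
  let ?x = "Re z" and ?y = "Im z"
  have "F (?x + ?y / 4) - F ?x < ?y / 4 * h (?x + ?y / 4)"
    "F (?x + ?y) - F (?x + ?y / 4) < 3 * ?y / 4 * h (?x + ?y)"
    using primitive_bounds(2)[of ?x "?x + ?y / 4"] primitive_bounds(2)[of "?x + ?y / 4" "?x + ?y"]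
      assms by (simp_all add: field_simps)
  then show "h (?x + ?y) - h (?x + ?y / 4) \<le> 4 * right_gap z"
    using assms by (simp add: right_gap_def mean_def field_simps)
  have "?y / 4 * h (?x - ?y / 4) < F ?x - F (?x - ?y / 4)"
    "3 * ?y / 4 * h (?x - ?y) < F (?x - ?y / 4) - F (?x - ?y)"
    using primitive_bounds(1)[of "?x - ?y / 4" ?x] primitive_bounds(1)[of "?x - ?y" "?x - ?y / 4"]
      assms by (simp_all add: field_simps)
  then show "h (?x - ?y / 4) - h (?x - ?y) \<le> 4 * left_gap z"
    using assms by (simp add: left_gap_def mean_def field_simps)
qed

text \<open>If the right increment is the larger one, the distortion is used at \<open>z\<close> and at \<open>(x - y / 4, y / 2)\<close>: the
interval \<open>[x - y / 4, x + y / 4]\<close> covers the part of the right increment next to \<open>x\<close>, and its neighbour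
\<open>[x - 3 * y / 4, x - y / 4]\<close> lies where \<open>gap_lower_bounds\<close> needs an increment. The other case is
symmetric.\<close>

lemma dilatation_le_sym_distortion:
  assumes "0 < Im z"
    and \<rho>: "\<And>w. \<bar>Re w - Re z\<bar> \<le> Im z \<Longrightarrow> Im z / 2 \<le> Im w \<Longrightarrow> Im w \<le> Im z \<Longrightarrow>
      sym_distortion h (Re w) (Im w) \<le> M"
  shows "BA_dilatation h z \<le> ereal (32 * M)"
proof -
  let ?x = "Re z" and ?y = "Im z"
  note b = incr_gap_bounds[OF assms(1)]
  have M: "1 \<le> M" using \<rho>[of z] sym_distortion_ge_1[of z] assms(1) by simp
  have ratio: "right_incr w \<le> M * left_incr w" "left_incr w \<le> M * right_incr w"
    if "\<bar>Re w - Re z\<bar> \<le> Im z" "Im z / 2 \<le> Im w" "Im w \<le> Im z" for w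
    using \<rho>[OF that] that assms(1) incr_gap_bounds(5,6)[of w]
    by (simp_all add: sym_distortion_incr field_simps)
  have "2 * ((right_incr z)\<^sup>2 + (left_incr z)\<^sup>2) \<le>
      32 * M * (right_incr z * left_gap z + left_incr z * right_gap z)"
  proof (cases "left_incr z \<le> right_incr z")
    case True
    let ?w = "Complex (?x - ?y / 4) (?y / 2)"
    have "?x - ?y / 4 + ?y / 2 = ?x + ?y / 4" by simp
    then have "h (?x + ?y / 4) - h ?x \<le> right_incr ?w"
      using h_less[of "?x - ?y / 4" ?x] assms(1) by (simp only: right_incr_def complex.sel) simp
    also have "\<dots> \<le> M * left_incr ?w"
      using assms(1) by (intro ratio) auto
    also have "\<dots> \<le> M * (4 * left_gap z)"
    proof -
      have "left_incr ?w \<le> h (?x - ?y / 4) - h (?x - ?y)"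
        using h_less[of "?x - ?y" "?x - ?y / 4 - ?y / 2"] assms(1) by (simp add: left_incr_def)
      then show ?thesis using gap_lower_bounds(2)[OF assms(1)] M by (intro mult_left_mono) auto
    qed
    finally have "2 * ((right_incr z)\<^sup>2 + (left_incr z)\<^sup>2) \<le>
      32 * max M M * (right_incr z * left_gap z + left_incr z * right_gap z)"
      using b True M ratio(1)[of z] gap_lower_bounds(1)[OF assms(1)] assms(1)
      by (intro quotient_bound[where r = "h (?x + ?y / 4) - h ?x"])
        (auto simp: right_incr_def left_incr_def mult_ac)
    then show ?thesis by simp
  next
    case False
    let ?w = "Complex (?x + ?y / 4) (?y / 2)"
    have "?x + ?y / 4 - ?y / 2 = ?x - ?y / 4" by simp
    then have "h ?x - h (?x - ?y / 4) \<le> left_incr ?w"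
      using h_less[of ?x "?x + ?y / 4"] assms(1) by (simp only: left_incr_def complex.sel) simp
    also have "\<dots> \<le> M * right_incr ?w"
      using assms(1) by (intro ratio) auto
    also have "\<dots> \<le> M * (4 * right_gap z)"
    proof -
      have "right_incr ?w \<le> h (?x + ?y) - h (?x + ?y / 4)"
        using h_less[of "?x + ?y / 4 + ?y / 2" "?x + ?y"] assms(1) by (simp add: right_incr_def)
      then show ?thesis using gap_lower_bounds(1)[OF assms(1)] M by (intro mult_left_mono) auto
    qed
    finally have "2 * ((left_incr z)\<^sup>2 + (right_incr z)\<^sup>2) \<le>
      32 * max M M * (left_incr z * right_gap z + right_incr z * left_gap z)"
      using b False M ratio(2)[of z] gap_lower_bounds(2)[OF assms(1)] assms(1)
      by (intro quotient_bound[where r = "h ?x - h (?x - ?y / 4)"])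
        (auto simp: right_incr_def left_incr_def mult_ac)
    then show ?thesis by (simp add: add.commute)
  qed
  then show ?thesis
    unfolding BA_dilatation_def frechet_derivative_BA_extension[OF assms(1)]
    by (rule dilatation_le_quotient[OF assms(1)])
qed

end

lemma increasing_homeo_primitive:
  assumes "increasing_homeo h"
  obtains F where "homeo_primitive h F"
proof -
  obtain g where "homeomorphism UNIV UNIV h g" and mono: "strict_mono h"
    using assms by (auto simp: increasing_homeo_def)
  then have cont: "continuous_on UNIV h" and surj: "surj h"
    by (auto simp: homeomorphism_def)
  have "\<exists>F. \<forall>x. - \<infinity> < ereal x \<longrightarrow> ereal x < \<infinity> \<longrightarrow> (F has_vector_derivative h x) (at x)"
    by (rule einterval_antiderivative) (use cont in \<open>auto simp: continuous_on_eq_continuous_at\<close>)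
  then obtain F where "\<And>x. (F has_real_derivative h x) (at x)"
    by (auto simp: has_real_derivative_iff_has_vector_derivative)
  then have "homeo_primitive h F"
    using cont surj mono by (simp add: homeo_primitive_def)
  then show ?thesis by (rule that)
qed

section \<open>Averages of BMO functions over hyperbolically bounded cells\<close>

lemma open_upper_half_plane: "open upper_half_plane"
  by (simp add: upper_half_plane_def open_halfspace_Im_gt)

lemma set_integrable_continuous_compact:
  fixes f :: "'a::euclidean_space \<Rightarrow> 'b::euclidean_space"
  assumes "compact S" "continuous_on S f"
  shows "set_integrable lebesgue S f"
proof -
  have "integrable lborel (\<lambda>x. indicator S x *\<^sub>R f x)"
    using assms by (rule borel_integrable_compact)
  then show ?thesis
    unfolding set_integrable_def by (subst integrable_completion) auto
qed

lemma L1_loc_continuous: "continuous_on U f \<Longrightarrow> L1_loc U f"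
  unfolding L1_loc_def by (auto intro: set_integrable_continuous_compact continuous_on_subset)

lemma set_integrable_const: "S \<in> lmeasurable \<Longrightarrow> set_integrable lebesgue S (\<lambda>_. c::real)"
  unfolding set_integrable_def by (intro integrable_scaleR_left) (simp add: lmeasurable_iff_integrable)

lemma LINT_const: "S \<in> lmeasurable \<Longrightarrow> (LINT w:S|lebesgue. c::real) = measure lebesgue S * c"
  using set_integral_const[of S lebesgue c] by (auto simp: fmeasurable_def)

lemma avg_mono:
  assumes "set_integrable lebesgue S f" "set_integrable lebesgue S g" "\<And>w. w \<in> S \<Longrightarrow> f w \<le> g w"
  shows "avg S f \<le> avg S g"
  unfolding avg_def by (intro mult_left_mono set_integral_mono assms) auto

text \<open>Comparison of averages over a set and a superset. It is used with \<open>c\<close> the average over \<open>B\<close>, which gives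
the mean oscillation, and with \<open>S = B\<close>.\<close>

lemma avg_diff_le:
  assumes S: "S \<in> lmeasurable" "S \<subseteq> B" "0 < measure lebesgue S" and B: "compact B"
    and A: "set_integrable lebesgue B A"
  shows "\<bar>avg S A - c\<bar> \<le> measure lebesgue B / measure lebesgue S * avg B (\<lambda>w. \<bar>A w - c\<bar>)"
proof -
  have Bm: "B \<in> lmeasurable" using B by (rule lmeasurable_compact)
  have AS: "set_integrable lebesgue S A" using A S by (auto intro: set_integrable_subset)
  have AcB: "set_integrable lebesgue B (\<lambda>w. \<bar>A w - c\<bar>)"
    by (intro set_integrable_abs set_integral_diff A set_integrable_const Bm)
  have "measure lebesgue S \<le> measure lebesgue B"
    using S Bm by (intro measure_mono_fmeasurable) auto
  then have mB: "0 < measure lebesgue B" using S by simp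
  have "(LINT w:S|lebesgue. A w - c) = (LINT w:S|lebesgue. A w) - measure lebesgue S * c"
    using set_integral_diff(2)[OF AS set_integrable_const[OF S(1), of c]] by (simp add: LINT_const S)
  then have "\<bar>avg S A - c\<bar> = \<bar>LINT w:S|lebesgue. A w - c\<bar> / measure lebesgue S"
    using S(3) by (simp add: avg_def field_simps)
  also have "\<bar>LINT w:S|lebesgue. A w - c\<bar> \<le> (LINT w:S|lebesgue. \<bar>A w - c\<bar>)"
    using set_integral_norm_bound[of lebesgue S "\<lambda>w. A w - c"]
      set_integral_diff(1)[OF AS set_integrable_const[OF S(1), of c]] by simp
  also have "\<dots> \<le> (LINT w:B|lebesgue. \<bar>A w - c\<bar>)"
  proof -
    have "set_integrable lebesgue S (\<lambda>w. \<bar>A w - c\<bar>)"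
      by (rule set_integrable_subset[OF AcB]) (use S in auto)
    then show ?thesis
      using AcB S(2) unfolding set_lebesgue_integral_def set_integrable_def
      by (intro integral_mono) (auto simp: indicator_def)
  qed
  also have "\<dots> / measure lebesgue S =
      measure lebesgue B / measure lebesgue S * avg B (\<lambda>w. \<bar>A w - c\<bar>)"
    using mB by (simp add: avg_def)
  finally show ?thesis using S(3) by (simp add: divide_right_mono)
qed

lemma mean_osc_le_twice_avg:
  assumes "compact B" "0 < measure lebesgue B" "set_integrable lebesgue B A"
  shows "mean_osc B A \<le> 2 * avg B (\<lambda>w. \<bar>A w - c\<bar>)"
proof -
  let ?a = "avg B A" and ?d = "avg B (\<lambda>w. \<bar>A w - c\<bar>)"
  have Bm: "B \<in> lmeasurable" using assms by (auto intro: lmeasurable_compact)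
  have i: "set_integrable lebesgue B (\<lambda>w. \<bar>A w - k\<bar>)" for k
    by (intro set_integrable_abs set_integral_diff assms set_integrable_const Bm)
  have "\<bar>?a - c\<bar> \<le> ?d" using avg_diff_le[of B B A c] assms Bm by simp
  then have "mean_osc B A \<le> avg B (\<lambda>w. \<bar>A w - c\<bar> + ?d)"
    unfolding mean_osc_def
    by (intro avg_mono i set_integral_add set_integrable_const Bm) auto
  also have "\<dots> = ?d + ?d"
    using set_integral_add(2)[OF i[of c] set_integrable_const[OF Bm, of ?d]] assms(2)
    by (simp add: avg_def LINT_const Bm field_simps)
  finally show ?thesis by simp
qed

lemma measure_complex_cbox:
  assumes "a \<le> b" "c \<le> d"
  shows "measure lebesgue (cbox (Complex a c) (Complex b d)) = (b - a) * (d - c)"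
  using assms by (subst measure_completion) (auto simp: content_cbox Basis_complex_def)

lemma in_cbox_Complex: "w \<in> cbox (Complex a c) (Complex b d) \<longleftrightarrow> a \<le> Re w \<and> Re w \<le> b \<and> c \<le> Im w \<and> Im w \<le> d"
  by (auto simp: mem_box Basis_complex_def)

lemma in_cball_components:
  assumes "w \<in> cball c r"
  shows "\<bar>Re w - Re c\<bar> \<le> r" "\<bar>Im w - Im c\<bar> \<le> r"
  using assms abs_Re_le_cmod[of "w - c"] abs_Im_le_cmod[of "w - c"]
  by (auto simp: dist_norm norm_minus_commute)

lemma measure_complex_cball_le:
  assumes "0 \<le> r"
  shows "measure lebesgue (cball c r :: complex set) \<le> (2 * r)\<^sup>2"
proof -
  have "cball c r \<subseteq> cbox (Complex (Re c - r) (Im c - r)) (Complex (Re c + r) (Im c + r))"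
    using in_cball_components[of _ c r] by (force simp: in_cbox_Complex abs_le_iff)
  then have "measure lebesgue (cball c r) \<le>
      measure lebesgue (cbox (Complex (Re c - r) (Im c - r)) (Complex (Re c + r) (Im c + r)))"
    by (intro measure_mono_fmeasurable) auto
  also have "\<dots> = (2 * r)\<^sup>2"
    using assms by (subst measure_complex_cbox) (auto simp: power2_eq_square)
  finally show ?thesis .
qed

lemma measure_complex_cball_ge:
  assumes "0 \<le> r"
  shows "r\<^sup>2 \<le> measure lebesgue (cball c r :: complex set)"
proof -
  let ?Q = "cbox (Complex (Re c - r / 2) (Im c - r / 2)) (Complex (Re c + r / 2) (Im c + r / 2))"
  have "?Q \<subseteq> cball c r"
  proof
    fix w assume "w \<in> ?Q"
    then have "\<bar>Re (c - w)\<bar> \<le> r / 2" "\<bar>Im (c - w)\<bar> \<le> r / 2"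
      unfolding abs_le_iff by (auto simp: in_cbox_Complex)
    then show "w \<in> cball c r" using cmod_le[of "c - w"] by (simp add: dist_norm)
  qed
  then have "measure lebesgue ?Q \<le> measure lebesgue (cball c r)"
    by (intro measure_mono_fmeasurable) (auto intro: lmeasurable_compact)
  moreover have "measure lebesgue ?Q = r\<^sup>2"
    using assms by (subst measure_complex_cbox) (auto simp: power2_eq_square)
  ultimately show ?thesis by simp
qed

text \<open>A set of bounded hyperbolic diameter around \<open>z\<close>. It contains the auxiliary points of
\<open>dilatation_le_sym_distortion\<close>, the horizontal segment of length \<open>2 * Im z\<close> centred at \<open>z\<close>, and one dyadic
step up or down.\<close>

definition nearby :: "complex \<Rightarrow> complex \<Rightarrow> bool" where
  "nearby z w \<longleftrightarrow> \<bar>Re w - Re z\<bar> \<le> Im z \<and> Im z / 2 \<le> Im w \<and> Im w \<le> 2 * Im z"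

text \<open>The point \<open>w\<close> is joined to height \<open>Y\<close> by dyadic steps. The sum of indicators counts them; this form of
\<open>log (Y / Im w)\<close> is integrated by adding up areas of strips.\<close>

lemma vertical_chain:
  fixes g :: "complex \<Rightarrow> real"
  assumes slow: "\<And>z w. 0 < Im z \<Longrightarrow> nearby z w \<Longrightarrow> \<bar>g w - g z\<bar> \<le> N"
    and "0 < Y" "Im w \<le> Y" "Y / 2 ^ n \<le> Im w"
  shows "\<bar>g w - g (Complex (Re w) Y)\<bar> \<le> N * (\<Sum>k<n. indicator {v. Im v \<le> Y / 2 ^ k} w)"
  using assms(3,4)
proof (induction n arbitrary: w)
  case 0
  then have "Complex (Re w) Y = w" by (simp add: complex_eq_iff)
  then show ?case by (simp only:) simp
next
  case (Suc n)
  have N: "0 \<le> N" using slow[of \<i> \<i>] by (simp add: nearby_def)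
  show ?case
  proof (cases "Y / 2 ^ n \<le> Im w")
    case True
    have "\<bar>g w - g (Complex (Re w) Y)\<bar> \<le> N * (\<Sum>k<n. indicator {v. Im v \<le> Y / 2 ^ k} w)"
      using Suc True by simp
    also have "\<dots> \<le> N * (\<Sum>k<Suc n. indicator {v. Im v \<le> Y / 2 ^ k} w)"
      using N by (intro mult_left_mono) auto
    finally show ?thesis .
  next
    case False
    define w' where "w' = Complex (Re w) (Y / 2 ^ n)"
    have Y: "Y / 2 ^ n \<le> Y / 2 ^ k" if "k \<le> n" for k
      using that \<open>0 < Y\<close> by (intro divide_left_mono) (auto intro: power_increasing)
    have w: "0 < Im w" using Suc.prems \<open>0 < Y\<close> by (meson divide_pos_pos less_le_trans zero_less_numeral zero_less_power)
    have "\<bar>g w' - g (Complex (Re w') Y)\<bar> \<le> N * (\<Sum>k<n. indicator {v. Im v \<le> Y / 2 ^ k} w')"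
      using Y[of 0] by (intro Suc.IH) (auto simp: w'_def)
    also have "(\<Sum>k<n. indicator {v. Im v \<le> Y / 2 ^ k} w') = (\<Sum>k<n. 1 :: real)"
      using Y by (intro sum.cong) (auto simp: w'_def indicator_def)
    finally have "\<bar>g w' - g (Complex (Re w) Y)\<bar> \<le> N * n" by (simp add: w'_def)
    moreover have "\<bar>g w' - g w\<bar> \<le> N"
      by (rule slow[OF w]) (use w False Suc.prems in \<open>auto simp: nearby_def w'_def field_simps\<close>)
    ultimately have "\<bar>g w - g (Complex (Re w) Y)\<bar> \<le> N * (n + 1)" by (simp add: algebra_simps)
    also have "real (n + 1) = (\<Sum>k<Suc n. 1 :: real)" by simp
    also have "\<dots> = (\<Sum>k<Suc n. indicator {v. Im v \<le> Y / 2 ^ k} w)"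
    proof (intro sum.cong refl)
      fix k assume "k \<in> {..<Suc n}"
      then show "1 = indicator {v. Im v \<le> Y / 2 ^ k} w"
        using Y[of k] False by (simp add: indicator_def)
    qed
    finally show ?thesis .
  qed
qed

text \<open>The oscillation over a ball is measured from the value at the centre \<open>c\<close>. On a ball of radius at most
\<open>Im c / 2\<close> the function varies by at most \<open>N\<close>. On a larger one the value at \<open>w\<close> differs from that at \<open>c\<close> by \<open>N\<close>
times the number of dyadic steps from \<open>w\<close> up to the height of \<open>c\<close>, plus one horizontal step. This number
has bounded mean, since the part of the ball below height \<open>Im c / 2 ^ k\<close> lies in a rectangle of area
\<open>2 * (Im c)\<^sup>2 / 2 ^ k\<close>.\<close>

lemma BMO_slowly_varying:
  assumes cont: "continuous_on upper_half_plane g"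
    and slow: "\<And>z w. 0 < Im z \<Longrightarrow> nearby z w \<Longrightarrow> \<bar>g w - g z\<bar> \<le> N"
  shows "g \<in> BMO upper_half_plane"
proof -
  have N: "0 \<le> N" using slow[of \<i> \<i>] by (simp add: nearby_def)
  have L1: "L1_loc upper_half_plane g" using cont by (rule L1_loc_continuous)
  have "mean_osc (cball c r) g \<le> 34 * N" if r: "0 < r" and sub: "cball c r \<subseteq> upper_half_plane" for c r
  proof -
    let ?B = "cball c r" and ?Y = "Im c"
    have Bm: "?B \<in> lmeasurable" by (auto intro: lmeasurable_compact)
    have mB: "0 < measure lebesgue ?B"
      using measure_complex_cball_ge[of r c] r by (smt (verit) zero_less_power2)
    have "c - of_real r * \<i> \<in> ?B" using r by (simp add: dist_norm norm_mult)
    then have "c - of_real r * \<i> \<in> upper_half_plane" using sub by blast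
    then have rY: "r < ?Y" by (simp add: upper_half_plane_def)
    have gB: "set_integrable lebesgue ?B g" using L1 sub by (simp add: L1_loc_def)
    have dB: "set_integrable lebesgue ?B (\<lambda>w. \<bar>g w - g c\<bar>)"
      by (intro set_integrable_abs set_integral_diff gB set_integrable_const Bm)
    have "avg ?B (\<lambda>w. \<bar>g w - g c\<bar>) \<le> 17 * N"
    proof (cases "r \<le> ?Y / 2")
      case True
      have "\<bar>g w - g c\<bar> \<le> N" if "w \<in> ?B" for w
        using in_cball_components[OF that] True r by (intro slow) (auto simp: nearby_def)
      then have "avg ?B (\<lambda>w. \<bar>g w - g c\<bar>) \<le> avg ?B (\<lambda>w. N)"
        by (intro avg_mono dB set_integrable_const Bm)
      also have "\<dots> = N" using mB by (simp add: avg_def LINT_const Bm)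
      finally show ?thesis using N by simp
    next
      case False
      obtain n where "(1/2::real) ^ n < (?Y - r) / ?Y"
        using real_arch_pow_inv[of "(?Y - r) / ?Y" "1/2"] rY r by auto
      then have n: "?Y / 2 ^ n \<le> ?Y - r" using rY r by (simp add: field_simps power_divide)
      define E where "E k = {v. Im v \<le> ?Y / 2 ^ k}" for k
      define \<psi> where "\<psi> w = N + N * (\<Sum>k<n. indicator (E k) w)" for w
      have Em: "?B \<inter> E k \<in> lmeasurable" for k
        unfolding E_def by (intro lmeasurable_compact compact_Int_closed compact_cball closed_halfspace_Im_le)
      have le: "\<bar>g w - g c\<bar> \<le> \<psi> w" if w: "w \<in> ?B" for w
      proof (cases "?Y \<le> Im w")
        case True
        then have "\<bar>g w - g c\<bar> \<le> N"
          using in_cball_components[OF w] rY r by (intro slow) (auto simp: nearby_def)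
        then show ?thesis using N by (simp add: \<psi>_def sum_nonneg add_increasing2)
      next
        case False
        have "\<bar>g w - g (Complex (Re w) ?Y)\<bar> \<le> N * (\<Sum>k<n. indicator (E k) w)"
          unfolding E_def
          by (rule vertical_chain[OF slow]) (use False in_cball_components[OF w] n rY r in auto)
        moreover have "\<bar>g (Complex (Re w) ?Y) - g c\<bar> \<le> N"
          using in_cball_components[OF w] rY r by (intro slow) (auto simp: nearby_def)
        ultimately show ?thesis using N unfolding \<psi>_def by linarith
      qed
      have \<psi>eq: "indicator ?B w *\<^sub>R \<psi> w =
          N * indicator ?B w + N * (\<Sum>k<n. indicator (?B \<inter> E k) w)" for w
        by (cases "w \<in> ?B") (simp_all add: \<psi>_def indicator_def)
      have iB: "integrable lebesgue (\<lambda>w. N * indicator ?B w)"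
        using Bm by (intro integrable_mult_right) (simp add: lmeasurable_iff_integrable)
      have iE: "integrable lebesgue (indicator (?B \<inter> E k) :: complex \<Rightarrow> real)" for k
        using Em by (simp add: lmeasurable_iff_integrable)
      then have iS: "integrable lebesgue (\<lambda>w. N * (\<Sum>k<n. indicator (?B \<inter> E k) w))"
        by (intro integrable_mult_right Bochner_Integration.integrable_sum)
      have i\<psi>: "set_integrable lebesgue ?B \<psi>"
        unfolding set_integrable_def \<psi>eq by (intro Bochner_Integration.integrable_add iB iS)
      have "(LINT w:?B|lebesgue. \<psi> w) =
          N * measure lebesgue ?B + N * (\<Sum>k<n. measure lebesgue (?B \<inter> E k))"
        unfolding set_lebesgue_integral_def \<psi>eq
        using iE by (subst Bochner_Integration.integral_add[OF iB iS]) simp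
      moreover have "(\<Sum>k<n. measure lebesgue (?B \<inter> E k)) \<le> 16 * measure lebesgue ?B"
      proof -
        have "(\<Sum>k<n. measure lebesgue (?B \<inter> E k)) \<le> (\<Sum>k<n. 2 * ?Y\<^sup>2 * (1/2) ^ k)"
        proof (rule sum_mono)
          fix k
          have "?B \<inter> E k \<subseteq> cbox (Complex (Re c - ?Y) 0) (Complex (Re c + ?Y) (?Y / 2 ^ k))"
          proof
            fix w assume w: "w \<in> ?B \<inter> E k"
            then show "w \<in> cbox (Complex (Re c - ?Y) 0) (Complex (Re c + ?Y) (?Y / 2 ^ k))"
              using in_cball_components[of w c r] rY by (auto simp: in_cbox_Complex E_def)
          qed
          then have "measure lebesgue (?B \<inter> E k) \<le>
              measure lebesgue (cbox (Complex (Re c - ?Y) 0) (Complex (Re c + ?Y) (?Y / 2 ^ k)))"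
            using Em by (intro measure_mono_fmeasurable) auto
          also have "\<dots> = 2 * ?Y\<^sup>2 * (1/2) ^ k"
            using rY r by (subst measure_complex_cbox) (auto simp: power2_eq_square power_divide)
          finally show "measure lebesgue (?B \<inter> E k) \<le> 2 * ?Y\<^sup>2 * (1/2) ^ k" .
        qed
        also have "\<dots> = 2 * ?Y\<^sup>2 * (\<Sum>k<n. (1/2) ^ k)" by (simp add: sum_distrib_left)
        also have "\<dots> \<le> 2 * ?Y\<^sup>2 * 2"
          by (intro mult_left_mono) (simp_all add: sum_gp_strict)
        also have "\<dots> \<le> 16 * r\<^sup>2"
        proof -
          have "?Y\<^sup>2 \<le> (2 * r)\<^sup>2" using False rY r by (intro power_mono) auto
          then show ?thesis by (simp add: power2_eq_square)
        qed
        also have "\<dots> \<le> 16 * measure lebesgue ?B" using measure_complex_cball_ge[of r c] r by simp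
        finally show ?thesis .
      qed
      then have "N * (\<Sum>k<n. measure lebesgue (?B \<inter> E k)) \<le> N * (16 * measure lebesgue ?B)"
        by (rule mult_left_mono[OF _ N])
      ultimately have "(LINT w:?B|lebesgue. \<psi> w) \<le>
          N * measure lebesgue ?B + N * (16 * measure lebesgue ?B)"
        by simp
      then have "(LINT w:?B|lebesgue. \<psi> w) \<le> 17 * N * measure lebesgue ?B" by simp
      then have "avg ?B \<psi> \<le> 17 * N" using mB by (simp add: avg_def field_simps)
      moreover have "avg ?B (\<lambda>w. \<bar>g w - g c\<bar>) \<le> avg ?B \<psi>"
        by (intro avg_mono dB i\<psi> le)
      ultimately show ?thesis by simp
    qed
    then show ?thesis using mean_osc_le_twice_avg[OF _ mB gB, of "g c"] by simp
  qed
  then show ?thesis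
    using L1 by (auto simp: BMO_def balls_in_def intro!: bdd_aboveI[of _ "34 * N"])
qed

lemma mean_osc_le_norm:
  assumes "A \<in> BMO U" "B \<in> balls_in U"
  shows "mean_osc B A \<le> BMO_norm U A"
  unfolding BMO_norm_def using assms by (auto simp: BMO_def intro: cSUP_upper)

text \<open>The shape is the cell of the point \<open>\<i>\<close>. The inner square bounds the area of a cell from below and the
outer rectangle keeps it away from the real line; convexity makes its boundary a null set.\<close>

locale whitney_shape =
  fixes S :: "complex set"
  assumes open_shape: "open S" and convex_shape: "convex S"
    and shape_inner: "cbox (Complex (-1/4) (3/4)) (Complex (1/4) (5/4)) \<subseteq> S"
    and shape_outer: "S \<subseteq> cbox (Complex (-1) (1/2)) (Complex 1 (3/2))"
begin

definition cell :: "complex \<Rightarrow> complex set" where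
  "cell z = {w. (w - of_real (Re z)) / of_real (Im z) \<in> S}"

lemma cell_outer:
  assumes "0 < Im z" "w \<in> cell z"
  shows "\<bar>Re w - Re z\<bar> \<le> Im z" "Im z / 2 \<le> Im w" "Im w \<le> 3 * Im z / 2"
proof -
  have "(w - of_real (Re z)) / of_real (Im z) \<in> cbox (Complex (-1) (1/2)) (Complex 1 (3/2))"
    using assms shape_outer by (auto simp: cell_def)
  then show "\<bar>Re w - Re z\<bar> \<le> Im z" "Im z / 2 \<le> Im w" "Im w \<le> 3 * Im z / 2"
    using assms by (auto simp: in_cbox_Complex field_simps)
qed

lemma cell_image:
  assumes "0 < Im z"
  shows "cell z = (\<lambda>s. of_real (Re z) + Im z *\<^sub>R s) ` S"
proof -
  have "w = of_real (Re z) + Im z *\<^sub>R ((w - of_real (Re z)) / of_real (Im z))" for w :: complex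
    using assms by (simp add: complex_eq_iff)
  moreover have "(of_real (Re z) + Im z *\<^sub>R s - of_real (Re z)) / of_real (Im z) = s" for s :: complex
    using assms by (simp add: scaleR_conv_of_real)
  ultimately show ?thesis by (force simp: cell_def)
qed

lemma cell_open: "0 < Im z \<Longrightarrow> open (cell z)"
  unfolding cell_def
  using open_vimage[OF open_shape, of "\<lambda>w. (w - of_real (Re z)) / of_real (Im z)"]
  by (simp add: vimage_def continuous_intros)

lemma cell_subset_cbox:
  "0 < Im z \<Longrightarrow> cell z \<subseteq> cbox (Complex (Re z - Im z) (Im z / 2)) (Complex (Re z + Im z) (3 * Im z / 2))"
proof
  fix w assume "0 < Im z" "w \<in> cell z"
  from cell_outer[OF this]
  show "w \<in> cbox (Complex (Re z - Im z) (Im z / 2)) (Complex (Re z + Im z) (3 * Im z / 2))"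
    unfolding in_cbox_Complex by linarith
qed

lemma cell_lmeasurable: "0 < Im z \<Longrightarrow> cell z \<in> lmeasurable"
  by (intro lmeasurable_open cell_open bounded_subset[OF bounded_cbox cell_subset_cbox])

lemma measure_cell_ge:
  assumes "0 < Im z"
  shows "(Im z)\<^sup>2 / 4 \<le> measure lebesgue (cell z)"
proof -
  let ?Q = "cbox (Complex (Re z - Im z / 4) (3 * Im z / 4)) (Complex (Re z + Im z / 4) (5 * Im z / 4))"
  have "?Q \<subseteq> cell z"
  proof
    fix w assume "w \<in> ?Q"
    then have "(w - of_real (Re z)) / of_real (Im z) \<in> cbox (Complex (-1/4) (3/4)) (Complex (1/4) (5/4))"
      using assms by (auto simp: in_cbox_Complex field_simps)
    then show "w \<in> cell z" using shape_inner by (auto simp: cell_def)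
  qed
  then have "measure lebesgue ?Q \<le> measure lebesgue (cell z)"
    using cell_lmeasurable[OF assms] by (intro measure_mono_fmeasurable) auto
  moreover have "measure lebesgue ?Q = (Im z)\<^sup>2 / 4"
    using assms by (subst measure_complex_cbox) (auto simp: power2_eq_square field_simps)
  ultimately show ?thesis by simp
qed

lemma measure_cell_pos: "0 < Im z \<Longrightarrow> 0 < measure lebesgue (cell z)"
  using measure_cell_ge[of z] by (smt (verit) divide_pos_pos zero_less_power)

text \<open>The cells of \<open>z\<close> and of all points near \<open>z\<close> lie in the rectangle of width \<open>6 * Im z\<close> over the heights
from \<open>Im z / 4\<close> to \<open>3 * Im z\<close>. A ball in the half-plane that contains this rectangle has to be large: it is
centred at height \<open>40 * Im z\<close> and ends at height \<open>Im z / 8\<close>. Its area is at most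
\<open>6400 * (Im z)\<^sup>2\<close>, against at least \<open>(Im z)\<^sup>2 / 16\<close> for a cell.\<close>

lemma cell_avg_slow:
  assumes A: "A \<in> BMO upper_half_plane" and z: "0 < Im z" and w: "nearby z w"
  shows "\<bar>avg (cell w) A - avg (cell z) A\<bar> \<le> 204800 * BMO_norm upper_half_plane A"
proof -
  let ?x = "Re z" and ?y = "Im z"
  define r where "r = 319 / 8 * ?y"
  define B where "B = cball (Complex ?x (40 * ?y)) r"
  have r: "0 < r" using z by (simp add: r_def)
  have BU: "B \<subseteq> upper_half_plane"
  proof
    fix v assume "v \<in> B"
    then have "\<bar>Im v - 40 * ?y\<bar> \<le> r"
      using in_cball_components(2)[of v "Complex ?x (40 * ?y)" r] by (simp add: B_def)
    then have "40 * ?y - r \<le> Im v" by linarith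
    then show "v \<in> upper_half_plane" using z by (simp add: upper_half_plane_def r_def)
  qed
  then have Bin: "B \<in> balls_in upper_half_plane" using r by (auto simp: balls_in_def B_def)
  have AB: "set_integrable lebesgue B A"
    using A BU by (auto simp: BMO_def L1_loc_def B_def)
  have *: "\<bar>avg (cell v) A - avg B A\<bar> \<le> 102400 * BMO_norm upper_half_plane A" if v: "nearby z v" for v
  proof -
    have y: "?y / 2 \<le> Im v" "Im v \<le> 2 * ?y" "0 < Im v" and x: "\<bar>Re v - ?x\<bar> \<le> ?y"
      using v z by (auto simp: nearby_def)
    have sub: "cell v \<subseteq> B"
    proof
      fix u assume u: "u \<in> cell v"
      \<comment> \<open>After rescaling by \<open>Im z\<close> the claim is \<open>3\<^sup>2 + (40 - 1/4)\<^sup>2 \<le> (40 - 1/8)\<^sup>2\<close>.\<close>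
      define a where "a = (Re u - ?x) / ?y"
      define b where "b = Im u / ?y"
      have "\<bar>Re u - ?x\<bar> \<le> 3 * ?y" using cell_outer[OF y(3) u] x y by linarith
      then have a: "\<bar>a\<bar> \<le> 3" using z by (simp add: a_def field_simps)
      have b: "1 / 4 \<le> b" "b \<le> 3" using cell_outer[OF y(3) u] y z by (auto simp: b_def field_simps)
      have "a\<^sup>2 \<le> 3\<^sup>2" using a power2_le_iff_abs_le[of 3 a] by simp
      moreover have "(40 - b)\<^sup>2 \<le> (159 / 4)\<^sup>2" using b by (intro power_mono) auto
      ultimately have "a\<^sup>2 + (40 - b)\<^sup>2 \<le> (319 / 8)\<^sup>2" by (simp add: power2_eq_square)
      then have "(a\<^sup>2 + (40 - b)\<^sup>2) * ?y\<^sup>2 \<le> (319 / 8)\<^sup>2 * ?y\<^sup>2" by (intro mult_right_mono) auto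
      moreover have "(a\<^sup>2 + (40 - b)\<^sup>2) * ?y\<^sup>2 = (a * ?y)\<^sup>2 + (40 * ?y - b * ?y)\<^sup>2"
        by (simp add: power2_eq_square algebra_simps)
      moreover have "a * ?y = Re u - ?x" "b * ?y = Im u" using z by (auto simp: a_def b_def)
      ultimately have "(?x - Re u)\<^sup>2 + (40 * ?y - Im u)\<^sup>2 \<le> r\<^sup>2"
        by (simp add: r_def power_mult_distrib power_divide power2_commute)
      then show "u \<in> B"
        using r by (simp add: B_def dist_norm cmod_def real_le_lsqrt)
    qed
    have "?y\<^sup>2 / 16 \<le> (Im v)\<^sup>2 / 4"
    proof -
      have "(?y / 2)\<^sup>2 \<le> (Im v)\<^sup>2" using y z by (intro power_mono) auto
      then show ?thesis by (simp add: power2_eq_square)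
    qed
    then have m: "?y\<^sup>2 / 16 \<le> measure lebesgue (cell v)" using measure_cell_ge[OF y(3)] by simp
    have "measure lebesgue B \<le> (2 * r)\<^sup>2" unfolding B_def using r by (intro measure_complex_cball_le) auto
    also have "\<dots> \<le> (80 * ?y)\<^sup>2" using z by (intro power_mono) (auto simp: r_def)
    finally have mB: "measure lebesgue B \<le> 6400 * ?y\<^sup>2" by (simp add: power_mult_distrib)
    have "\<bar>avg (cell v) A - avg B A\<bar> \<le>
        measure lebesgue B / measure lebesgue (cell v) * mean_osc B A"
      unfolding mean_osc_def
      by (rule avg_diff_le[OF cell_lmeasurable[OF y(3)] sub measure_cell_pos[OF y(3)] _ AB])
        (simp add: B_def)
    also have "\<dots> \<le> (6400 * ?y\<^sup>2) / (?y\<^sup>2 / 16) * mean_osc B A"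
    proof (intro mult_right_mono frac_le m mB)
      show "0 \<le> mean_osc B A"
        by (simp add: mean_osc_def avg_def set_lebesgue_integral_def)
    qed (use z in auto)
    also have "\<dots> = 102400 * mean_osc B A" using z by simp
    finally show ?thesis using mean_osc_le_norm[OF A Bin] by simp
  qed
  show ?thesis using *[OF w] *[of z] z by (simp add: nearby_def)
qed

text \<open>Dominated convergence: away from the frontier of the cell of \<open>z\<close>, membership in the cell of a point
close to \<open>z\<close> does not depend on that point.\<close>

lemma continuous_on_LINT_cell:
  assumes A: "L1_loc upper_half_plane A"
  shows "continuous_on upper_half_plane (\<lambda>z. LINT w:cell z|lebesgue. A w :: real)"
proof (rule continuous_at_imp_continuous_on, rule ballI)
  fix z0 assume "z0 \<in> upper_half_plane"
  then have z0: "0 < Im z0" by (simp add: upper_half_plane_def)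
  let ?N = "ball z0 (Im z0 / 2)"
  let ?K = "cbox (Complex (Re z0 - 3 * Im z0) (Im z0 / 4)) (Complex (Re z0 + 3 * Im z0) (3 * Im z0))"
  have N: "\<bar>Re z - Re z0\<bar> < Im z0 / 2" "Im z0 / 2 < Im z" "Im z < 3 * Im z0 / 2" if "z \<in> ?N" for z
    using that abs_Re_le_cmod[of "z0 - z"] abs_Im_le_cmod[of "z0 - z"]
    unfolding mem_ball dist_norm minus_complex.sel by linarith+
  have "?K \<subseteq> upper_half_plane" using z0 by (auto simp: in_cbox_Complex upper_half_plane_def)
  then have AK: "set_integrable lebesgue ?K A" using A by (auto simp: L1_loc_def)
  have sub: "cell z \<subseteq> ?K" if "z \<in> ?N" for z
  proof
    fix w assume "w \<in> cell z"
    then have "\<bar>Re w - Re z\<bar> \<le> Im z" "Im z / 2 \<le> Im w" "Im w \<le> 3 * Im z / 2"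
      using cell_outer[of z w] N[OF that] z0 by auto
    then show "w \<in> ?K" using N[OF that] z0 unfolding in_cbox_Complex by linarith
  qed
  have AC: "set_integrable lebesgue (cell z) A" if "z \<in> ?N" for z
    using set_integrable_subset[OF AK _ sub[OF that]] cell_open[of z] N[OF that] z0 by auto
  have "continuous_on ?N (\<lambda>z. LINT w:cell z|lebesgue. A w)"
    unfolding continuous_on_sequentially comp_def
  proof (intro allI ballI impI, elim conjE)
    fix Z z assume z: "z \<in> ?N" and Z: "\<forall>n. Z n \<in> ?N" "Z \<longlonglongrightarrow> z"
    have y: "0 < Im z" using N[OF z] z0 by simp
    show "(\<lambda>n. LINT w:cell (Z n)|lebesgue. A w) \<longlonglongrightarrow> (LINT w:cell z|lebesgue. A w)"
      unfolding set_lebesgue_integral_def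
    proof (rule integral_dominated_convergence[where w = "\<lambda>w. norm (indicator ?K w *\<^sub>R A w)"])
      show "integrable lebesgue (\<lambda>w. norm (indicator ?K w *\<^sub>R A w))"
        using AK unfolding set_integrable_def by (rule integrable_norm)
      show "AE w in lebesgue. norm (indicator (cell (Z n)) w *\<^sub>R A w) \<le> norm (indicator ?K w *\<^sub>R A w)" for n
        using sub[of "Z n"] Z by (intro AE_I2) (auto simp: indicator_def)
      have "convex (cell z)"
        unfolding cell_image[OF y] by (rule convex_affinity[OF convex_shape])
      then have "AE w in lebesgue. w \<notin> frontier (cell z)"
        using negligible_convex_frontier by (auto simp: negligible_iff_null_sets intro: AE_not_in)
      then show "AE w in lebesgue. (\<lambda>n. indicator (cell (Z n)) w *\<^sub>R A w) \<longlonglongrightarrow> indicator (cell z) w *\<^sub>R A w"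
      proof eventually_elim
        fix w assume w: "w \<notin> frontier (cell z)"
        define T where "T v = (w - of_real (Re v)) / of_real (Im v)" for v
        have T: "(\<lambda>n. T (Z n)) \<longlonglongrightarrow> T z"
          unfolding T_def using y Z(2) by (intro tendsto_intros) auto
        have "eventually (\<lambda>n. (w \<in> cell (Z n)) = (w \<in> cell z)) sequentially"
        proof (cases "w \<in> cell z")
          case True
          then have "T z \<in> S" by (simp add: T_def cell_def)
          then have "eventually (\<lambda>n. T (Z n) \<in> S) sequentially"
            by (rule topological_tendstoD[OF T open_shape])
          then show ?thesis using True by (simp add: cell_def T_def)
        next
          case False
          then have "w \<notin> closure (cell z)"
            using w cell_open[OF y] by (simp add: frontier_def interior_open)
          moreover have "w \<in> closure (cell z)" if "T z \<in> closure S"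
          proof -
            let ?f = "\<lambda>s. of_real (Re z) + Im z *\<^sub>R s"
            have "?f ` closure S \<subseteq> closure (?f ` S)"
              by (rule image_closure_subset) (auto intro!: continuous_intros closure_subset)
            moreover have "w = ?f (T z)" using y by (simp add: T_def scaleR_conv_of_real)
            ultimately show ?thesis using that cell_image[OF y] by auto
          qed
          ultimately have "T z \<in> - closure S" by auto
          then have "eventually (\<lambda>n. T (Z n) \<in> - closure S) sequentially"
            by (intro topological_tendstoD[OF T]) auto
          then show ?thesis
            using False closure_subset[of S] by (auto elim!: eventually_mono simp: cell_def T_def)
        qed
        then show "(\<lambda>n. indicator (cell (Z n)) w *\<^sub>R A w) \<longlonglongrightarrow> indicator (cell z) w *\<^sub>R A w"
          by (intro tendsto_eventually) (auto elim!: eventually_mono simp: indicator_def)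
      qed
    qed (use AC z Z in \<open>auto simp: set_integrable_def intro: borel_measurable_integrable\<close>)
  qed
  then show "isCont (\<lambda>z. LINT w:cell z|lebesgue. A w) z0"
    using z0 by (auto simp: continuous_on_eq_continuous_at)
qed

lemma continuous_on_cell_avg:
  assumes "L1_loc upper_half_plane A"
  shows "continuous_on upper_half_plane (\<lambda>z. avg (cell z) A)"
proof -
  have "continuous_on upper_half_plane (\<lambda>z. LINT w:cell z|lebesgue. 1 :: real)"
    by (intro continuous_on_LINT_cell L1_loc_continuous continuous_intros)
  then have "continuous_on upper_half_plane (\<lambda>z. measure lebesgue (cell z))"
    by (rule continuous_on_cong[THEN iffD1, rotated -1])
      (auto simp: LINT_const cell_lmeasurable upper_half_plane_def)
  then show ?thesis
    unfolding avg_def using continuous_on_LINT_cell[OF assms] measure_cell_pos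
    by (intro continuous_intros) (auto simp: upper_half_plane_def less_imp_neq[symmetric])
qed

end

lemma whitney_shape_ball: "whitney_shape (ball \<i> (1/2))"
proof
  show "cbox (Complex (- 1 / 4) (3 / 4)) (Complex (1 / 4) (5 / 4)) \<subseteq> ball \<i> (1 / 2)"
  proof
    fix w assume "w \<in> cbox (Complex (- 1 / 4) (3 / 4)) (Complex (1 / 4) (5 / 4))"
    then have w: "\<bar>Re w\<bar> \<le> 1/4" "\<bar>1 - Im w\<bar> \<le> 1/4"
      unfolding in_cbox_Complex abs_le_iff by auto
    have "(Re w)\<^sup>2 \<le> (1/4)\<^sup>2" "(1 - Im w)\<^sup>2 \<le> (1/4)\<^sup>2"
      using w by (simp_all only: power2_le_iff_abs_le)
    then have "(Re w)\<^sup>2 + (1 - Im w)\<^sup>2 < (1/2)\<^sup>2" by (simp add: power2_eq_square)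
    then have "sqrt ((Re w)\<^sup>2 + (1 - Im w)\<^sup>2) < 1/2" by (intro real_less_lsqrt) auto
    then show "w \<in> ball \<i> (1/2)" by (simp add: dist_norm cmod_def)
  qed
  show "ball \<i> (1 / 2) \<subseteq> cbox (Complex (- 1) (1 / 2)) (Complex 1 (3 / 2))"
  proof
    fix w assume "w \<in> ball \<i> (1/2)"
    then have "w \<in> cball \<i> (1/2)" by simp
    from in_cball_components[OF this] have "\<bar>Re w\<bar> \<le> 1/2" "\<bar>Im w - 1\<bar> \<le> 1/2" by simp_all
    then show "w \<in> cbox (Complex (- 1) (1 / 2)) (Complex 1 (3 / 2))"
      unfolding in_cbox_Complex complex.sel by linarith
  qed
qed auto

lemma whitney_shape_box: "whitney_shape (box (Complex (-1) (1/2)) (Complex 1 (3/2)))"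
proof
  show "cbox (Complex (- 1 / 4) (3 / 4)) (Complex (1 / 4) (5 / 4)) \<subseteq> box (Complex (-1) (1/2)) (Complex 1 (3/2))"
    by (auto simp: in_cbox_Complex mem_box Basis_complex_def)
qed (auto simp: box_subset_cbox)

lemma avg_hat_cell:
  assumes "0 < Im z"
  shows "avg_hat A z = avg (whitney_shape.cell (ball \<i> (1/2)) z) A"
proof -
  interpret whitney_shape "ball \<i> (1/2)" by (rule whitney_shape_ball)
  have "w \<in> cell z \<longleftrightarrow> w \<in> ball z (Im z / 2)" for w
  proof -
    have "\<i> - (w - of_real (Re z)) / of_real (Im z) = (z - w) / of_real (Im z)"
      using assms by (simp add: complex_eq_iff field_simps)
    then show ?thesis
      using assms by (simp add: cell_def dist_norm norm_divide field_simps)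
  qed
  then have "cell z = ball z (Im z / 2)" by blast
  then show ?thesis by (simp add: avg_hat_def)
qed

lemma avg_check_cell:
  assumes "0 < Im z"
  shows "avg_check A z = avg (whitney_shape.cell (box (Complex (-1) (1/2)) (Complex 1 (3/2))) z) A"
proof -
  interpret whitney_shape "box (Complex (-1) (1/2)) (Complex 1 (3/2))" by (rule whitney_shape_box)
  have "cell z = box (Complex (Re z - Im z) (Im z / 2)) (Complex (Re z + Im z) (3 * Im z / 2))"
    using assms by (auto simp: cell_def mem_box Basis_complex_def field_simps)
  then show ?thesis by (simp add: avg_check_def)
qed

section \<open>The extension as an orientation-preserving homeomorphism\<close>

context homeo_primitive
begin

text \<open>In the coordinates \<open>(u + v, u - v)\<close> the extension consists of the means over \<open>[x, x + y]\<close> and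
\<open>[x - y, x]\<close>, and the identity of \<open>x + y\<close> and \<open>x - y\<close>. If the increments of \<open>x\<close> and \<open>y\<close> have the same
sign, the first interval moves monotonically, and if they have opposite signs, the second one does. So
in one of the two coordinates the increments of both maps are nonzero and of the same sign, which
excludes a zero of any convex combination.\<close>

lemma segment_homotopy_nonzero:
  assumes z: "0 < Im z" and w: "0 < Im w" and "z \<noteq> w" and s: "0 \<le> s" "s \<le> 1"
  shows "(1 - s) *\<^sub>R (BA_extension h w - BA_extension h z) + s *\<^sub>R (w - z) \<noteq> 0"
proof
  assume 0: "(1 - s) *\<^sub>R (BA_extension h w - BA_extension h z) + s *\<^sub>R (w - z) = 0"
  define dx where "dx = Re w - Re z"
  define dy where "dy = Im w - Im z"
  define da where "da = mean (Re w) (Re w + Im w) - mean (Re z) (Re z + Im z)"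
  define db where "db = mean (Re w - Im w) (Re w) - mean (Re z - Im z) (Re z)"
  have "(1 - s) * ((da + db) / 2) + s * dx = 0" "(1 - s) * ((da - db) / 2) + s * dy = 0"
    using arg_cong[OF 0, of Re] arg_cong[OF 0, of Im]
    by (simp_all add: BA_extension_mean z w da_def db_def dx_def dy_def field_simps)
  then have a0: "(1 - s) * da + s * (dx + dy) = 0" and b0: "(1 - s) * db + s * (dx - dy) = 0"
    by (simp_all add: field_simps)
  have conv: "(1 - s) * p + s * q > 0" if "p > 0" "q > 0" for p q
    using that s by (cases "s = 0") (auto intro!: add_nonneg_pos)
  have ne: "dx \<noteq> 0 \<or> dy \<noteq> 0" using \<open>z \<noteq> w\<close> by (auto simp: dx_def dy_def complex_eq_iff)
  consider "0 \<le> dx" "0 \<le> dy" | "dx \<le> 0" "dy \<le> 0" | "0 \<le> dx" "dy \<le> 0" | "dx \<le> 0" "0 \<le> dy"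
    by linarith
  then show False
  proof cases
    case 1
    then have "0 < da" using ne mean_strict_mono[of "Re z" "Re z + Im z" "Re w" "Re w + Im w"] z w
      by (auto simp: da_def dx_def dy_def)
    then show False using conv[of da "dx + dy"] 1 ne a0 by auto
  next
    case 2
    then have "da < 0" using ne mean_strict_mono[of "Re w" "Re w + Im w" "Re z" "Re z + Im z"] z w
      by (auto simp: da_def dx_def dy_def)
    then show False using conv[of "- da" "- (dx + dy)"] 2 ne a0 by (auto simp: algebra_simps)
  next
    case 3
    then have "0 < db" using ne mean_strict_mono[of "Re z - Im z" "Re z" "Re w - Im w" "Re w"] z w
      by (auto simp: db_def dx_def dy_def)
    then show False using conv[of db "dx - dy"] 3 ne b0 by auto
  next
    case 4
    then have "db < 0" using ne mean_strict_mono[of "Re w - Im w" "Re w" "Re z - Im z" "Re z"] z w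
      by (auto simp: db_def dx_def dy_def)
    then show False using conv[of "- db" "- (dx - dy)"] 4 ne b0 by (auto simp: algebra_simps)
  qed
qed

lemma inj_on_BA_extension: "inj_on (BA_extension h) upper_half_plane"
proof (rule inj_onI, rule ccontr)
  fix z w assume "z \<in> upper_half_plane" "w \<in> upper_half_plane"
    "BA_extension h z = BA_extension h w" "z \<noteq> w"
  then show False using segment_homotopy_nonzero[of z w 0] by (simp add: upper_half_plane_def)
qed

lemma continuous_on_BA_extension: "continuous_on upper_half_plane (BA_extension h)"
  unfolding upper_half_plane_def
  by (intro continuous_at_imp_continuous_on ballI has_derivative_continuous)
    (auto intro: has_derivative_BA_extension)

lemma orientation_preserving_BA_extension:
  "orientation_preserving upper_half_plane (BA_extension h)"
  unfolding orientation_preserving_def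
proof (intro allI impI, elim conjE)
  fix a :: complex and r :: real
  assume r: "0 < r" and sub: "cball a r \<subseteq> upper_half_plane"
  let ?H = "BA_extension h"
  have a: "0 < Im a" using subsetD[OF sub, of a] r by (simp add: upper_half_plane_def)
  have im: "path_image (circlepath a r) \<subseteq> upper_half_plane"
    using sub r by (auto simp: path_image_circlepath)
  have w: "0 < Im (circlepath a r t)" "circlepath a r t \<noteq> a" if "t \<in> {0..1}" for t
  proof -
    have "circlepath a r t \<in> upper_half_plane"
      using im that unfolding path_image_def by blast
    then show "0 < Im (circlepath a r t)" by (simp add: upper_half_plane_def)
    show "circlepath a r t \<noteq> a" using r by (simp add: circlepath)
  qed
  have hom: "homotopic_loops (- {0}) (\<lambda>t. (?H \<circ> circlepath a r) t - ?H a) (\<lambda>t. circlepath a r t - a)"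
  proof (rule homotopic_loops_linear)
    show "path (\<lambda>t. (?H \<circ> circlepath a r) t - ?H a)"
    proof -
      have "path (?H \<circ> circlepath a r)"
        by (rule path_continuous_image[OF path_circlepath])
          (rule continuous_on_subset[OF continuous_on_BA_extension im])
      then have "continuous_on {0..1} (\<lambda>t. ?H (circlepath a r t))"
        by (simp add: path_def o_def)
      then show ?thesis unfolding path_def o_def by (intro continuous_on_diff continuous_on_const)
    qed
    show "path (\<lambda>t. circlepath a r t - a)"
      unfolding path_def using path_circlepath[of a r]
      by (auto intro!: continuous_intros simp: path_def)
    show "closed_segment ((?H \<circ> circlepath a r) t - ?H a) (circlepath a r t - a) \<subseteq> - {0}"
      if "t \<in> {0..1}" for t
      using segment_homotopy_nonzero[OF a w(1)[OF that]] w(2)[OF that]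
      by (auto simp: closed_segment_def)
  qed (simp_all add: pathstart_def pathfinish_def circlepath)
  have "winding_number (?H \<circ> circlepath a r) (?H a) =
      winding_number (\<lambda>t. (?H \<circ> circlepath a r) t - ?H a) 0"
    by (rule winding_number_offset)
  also have "\<dots> = winding_number (\<lambda>t. circlepath a r t - a) 0"
    by (rule winding_number_homotopic_loops[OF hom])
  also have "\<dots> = winding_number (circlepath a r) a"
    by (rule winding_number_offset[symmetric])
  also have "\<dots> = 1" by (rule winding_number_circlepath_centre[OF r])
  finally show "winding_number (?H \<circ> circlepath a r) (?H a) = 1" .
qed

lemma primitive_continuous: "continuous_on UNIV F"
  using primitive by (auto intro!: continuous_at_imp_continuous_on DERIV_isCont)

lemma h_le_iff: "h s \<le> h t \<longleftrightarrow> s \<le> t"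
  using mono by (rule strict_mono_less_eq)

lemma left_mean_hits:
  assumes "0 < y"
  shows "\<exists>x. mean (x - y) x = b"
proof -
  obtain q where q: "h q = b" using surj by (metis surjD)
  have "continuous_on {q..q + y} (\<lambda>x. mean (x - y) x)"
    unfolding mean_def
    by (intro continuous_intros continuous_on_compose2[OF primitive_continuous]) (use assms in auto)
  moreover have "mean (q - y) q \<le> b" "b \<le> mean (q + y - y) (q + y)"
    using mean_bounds[of "q - y" q] mean_bounds[of q "q + y"] assms q by auto
  ultimately show ?thesis
    using IVT'[of "\<lambda>x. mean (x - y) x" q b "q + y"] assms by auto
qed

text \<open>Let \<open>a > b\<close> be the values that the means over \<open>[x, x + y]\<close> and \<open>[x - y, x]\<close> have to take. For each \<open>y\<close>
some \<open>x = X y\<close> produces the mean \<open>b\<close> on the left, and \<open>X\<close> is 1-Lipschitz: when \<open>y\<close> grows, the two end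
points of \<open>[X y - y, X y]\<close> must move in opposite directions. So the mean over \<open>[X y, X y + y]\<close> depends
continuously on \<open>y\<close>, and the intermediate value theorem finds a \<open>y\<close> at which it is \<open>a\<close>. All these
intervals \<open>[X y - y, X y]\<close> contain the point \<open>q\<close> with \<open>h q = b\<close>, which controls the mean for small and
for large \<open>y\<close>.\<close>

lemma BA_extension_surj: "BA_extension h ` upper_half_plane = upper_half_plane"
proof (intro equalityI subsetI)
  fix w assume "w \<in> BA_extension h ` upper_half_plane"
  then obtain z where z: "0 < Im z" "w = BA_extension h z" by (auto simp: upper_half_plane_def)
  then show "w \<in> upper_half_plane"
    using mean_strict_mono[of "Re z - Im z" "Re z" "Re z" "Re z + Im z"]
    by (simp add: upper_half_plane_def BA_extension_mean)
next
  fix w assume "w \<in> upper_half_plane"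
  then have w: "0 < Im w" by (simp add: upper_half_plane_def)
  define a where "a = Re w + Im w"
  define b where "b = Re w - Im w"
  have ba: "b < a" using w by (simp add: a_def b_def)
  obtain p q where pq: "h p = a" "h q = b" using surj by (metis surjD)
  have "q < p" using h_le_iff[of p q] pq ba by auto
  define X where "X y = (SOME x. mean (x - y) x = b)" for y
  have X: "mean (X y - y) (X y) = b" if "0 < y" for y
    unfolding X_def using left_mean_hits[OF that] by (rule someI_ex)
  have Xq: "X y - y \<le> q" "q \<le> X y" if "0 < y" for y
    using mean_bounds[of "X y - y" "X y"] X[OF that] that pq(2) h_le_iff[of "X y - y" q] h_le_iff[of q "X y"]
    by auto
  have Xmono: "X y \<le> X y'" "X y' - y' \<le> X y - y" if "0 < y" "y \<le> y'" for y y'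
  proof -
    show "X y \<le> X y'"
    proof (rule ccontr)
      assume "\<not> ?thesis"
      then have "mean (X y' - y') (X y') < mean (X y - y) (X y)"
        using that by (intro mean_strict_mono) auto
      then show False using X that by simp
    qed
    show "X y' - y' \<le> X y - y"
    proof (rule ccontr)
      assume "\<not> ?thesis"
      then have "mean (X y - y) (X y) < mean (X y' - y') (X y')"
        using that by (intro mean_strict_mono) auto
      then show False using X that by simp
    qed
  qed
  have "\<bar>X y - X y'\<bar> \<le> \<bar>y - y'\<bar>" if "0 < y" "0 < y'" for y y'
    using Xmono[of y y'] Xmono[of y' y] that by (cases "y \<le> y'") auto
  then have Xlip: "1-lipschitz_on {0<..} X"
    by (auto simp: lipschitz_on_def dist_real_def)
  have Xcont: "continuous_on {0<..} X" by (rule lipschitz_on_continuous_on[OF Xlip])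
  define G where "G y = mean (X y) (X y + y)" for y
  have Gcont: "continuous_on {0<..} G"
    unfolding G_def mean_def
    by (intro continuous_intros continuous_on_compose2[OF primitive_continuous] Xcont) auto
  define y1 where "y1 = (p - q) / 2"
  have y1: "0 < y1" using \<open>q < p\<close> by (simp add: y1_def)
  have G1: "G y1 \<le> a"
  proof -
    have "G y1 < h (X y1 + y1)" unfolding G_def using y1 by (intro mean_bounds) auto
    also have "\<dots> \<le> h p" using Xq(1)[OF y1] by (simp add: h_le_iff y1_def field_simps)
    finally show ?thesis using pq by simp
  qed
  \<comment> \<open>On \<open>[q, p']\<close> the values of \<open>h\<close> are at least \<open>b\<close>, on an interval of the same length to the right
    of \<open>p'\<close> at least \<open>2 * a - b\<close>; so the mean over both is at least \<open>a\<close>.\<close>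
  obtain p' where p': "h p' = 2 * a - b" using surj by (metis surjD)
  have pp': "p < p'"
  proof -
    have "h p < h p'" using p' pq ba by simp
    then show ?thesis by (metis h_le_iff not_le)
  qed
  define y2 where "y2 = 2 * (p' - q)"
  have y2: "0 < y2" "y1 \<le> y2" using \<open>q < p\<close> pp' by (simp_all add: y2_def y1_def)
  have G2: "a \<le> G y2"
  proof -
    have "mean q (q + y2) \<le> G y2"
      unfolding G_def using Xq(2)[OF y2(1)] y2 by (intro mean_mono) auto
    moreover have "a \<le> mean q (q + y2)"
    proof -
      have "(p' - q) * h q < F p' - F q" "(p' - q) * h p' < F (q + y2) - F p'"
        using primitive_bounds(1)[of q p'] primitive_bounds(1)[of p' "q + y2"] pp' \<open>q < p\<close>
        by (simp_all add: y2_def)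
      then have "(p' - q) * (h q + h p') \<le> F (q + y2) - F q" by (simp add: algebra_simps)
      moreover have "h q + h p' = 2 * a" using pq p' by simp
      ultimately have "a * y2 \<le> F (q + y2) - F q" by (simp add: y2_def mult_ac)
      then show ?thesis using y2 by (simp add: mean_def pos_le_divide_eq)
    qed
    ultimately show ?thesis by simp
  qed
  have "continuous_on {y1..y2} G" by (rule continuous_on_subset[OF Gcont]) (use y1 in auto)
  then obtain y where y: "y1 \<le> y" "G y = a"
    using IVT'[of G y1 a y2] G1 G2 y2 by auto
  have "BA_extension h (Complex (X y) y) = w"
    using y y1 X[of y] by (simp add: complex_eq_iff BA_extension_mean G_def a_def b_def)
  then show "w \<in> BA_extension h ` upper_half_plane"
    using y y1 by (intro image_eqI[of _ _ "Complex (X y) y"]) (auto simp: upper_half_plane_def)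
qed

lemma homeomorphism_BA_extension:
  "\<exists>G. homeomorphism upper_half_plane upper_half_plane (BA_extension h) G"
  using invariance_of_domain_homeomorphism[OF open_upper_half_plane continuous_on_BA_extension _
      inj_on_BA_extension] BA_extension_surj
  by (metis order_refl)

end

section \<open>Weak differentials of continuously differentiable maps\<close>

text \<open>The difference quotients of \<open>f\<close> in direction \<open>b\<close> have integral zero by translation invariance and
converge to the directional derivative. The mean value inequality bounds them by a constant on a compact
set outside of which they vanish.\<close>

lemma integral_directional_derivative_zero:
  fixes f :: "'a::euclidean_space \<Rightarrow> 'b::euclidean_space"
  assumes der: "\<And>x. (f has_derivative f' x) (at x)"
    and cont: "continuous_on UNIV (\<lambda>x. f' x b)"
    and K: "compact K" and supp: "\<And>x. x \<notin> K \<Longrightarrow> f x = 0"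
  shows "(\<integral>x. f' x b \<partial>lebesgue) = 0"
proof -
  define q where "q n x = real (Suc n) *\<^sub>R (f (x + (1 / real (Suc n)) *\<^sub>R b) - f x)" for n x
  \<comment> \<open>All difference quotients vanish outside \<open>K'\<close>, and the segments that they are taken over, starting
    in \<open>K'\<close>, stay in \<open>K''\<close>.\<close>
  define K' where "K' = (\<lambda>(x, t). x - t *\<^sub>R b) ` (K \<times> {0..1})"
  define K'' where "K'' = (\<lambda>(x, t). x + t *\<^sub>R b) ` (K' \<times> {0..1})"
  have K': "compact K'" "compact K''"
    unfolding K''_def K'_def case_prod_unfold
    by (intro compact_continuous_image continuous_intros compact_Times K compact_Icc)+
  have fcont: "continuous_on UNIV f"
    using der has_derivative_continuous by (blast intro: continuous_at_imp_continuous_on)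
  have qcont: "continuous_on UNIV (q n)" for n
    unfolding q_def by (intro continuous_intros continuous_on_compose2[OF fcont]) auto
  have fint: "integrable lborel f"
  proof -
    have "(\<lambda>x. indicator K x *\<^sub>R f x) = f" using supp by (auto simp: fun_eq_iff indicator_def)
    then show ?thesis using borel_integrable_compact[OF K, of f] fcont by (auto intro: continuous_on_subset)
  qed
  have shift: "integrable lborel (\<lambda>x. f (x + c))" "(\<integral>x. f (x + c) \<partial>lborel) = (\<integral>x. f x \<partial>lborel)" for c
  proof -
    have fm: "f \<in> borel_measurable borel" using fcont by (rule borel_measurable_continuous_onI)
    have "integrable (distr lborel borel ((+) c)) f" using fint by (simp add: lborel_distr_plus)
    then show "integrable lborel (\<lambda>x. f (x + c))"
      by (subst (asm) integrable_distr_eq) (auto simp: add.commute fm)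
    have "(\<integral>x. f x \<partial>lborel) = (\<integral>x. f x \<partial>distr lborel borel ((+) c))" by (simp add: lborel_distr_plus)
    also have "\<dots> = (\<integral>x. f (x + c) \<partial>lborel)"
      using fm by (subst integral_distr) (auto simp: add.commute)
    finally show "(\<integral>x. f (x + c) \<partial>lborel) = (\<integral>x. f x \<partial>lborel)" by simp
  qed
  have q0: "(\<integral>x. q n x \<partial>lborel) = 0" for n
    unfolding q_def using shift fint by simp
  obtain M where M: "\<And>x. x \<in> K'' \<Longrightarrow> norm (f' x b) \<le> M"
  proof -
    have "compact ((\<lambda>x. f' x b) ` K'')"
      using K' cont by (intro compact_continuous_image continuous_on_subset[OF cont]) auto
    then have "bounded ((\<lambda>x. f' x b) ` K'')" by (rule compact_imp_bounded)
    then show ?thesis using that by (auto simp: bounded_iff)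
  qed
  have lim: "(\<lambda>n. q n x) \<longlonglongrightarrow> f' x b" for x
  proof -
    have "((\<lambda>t. f (x + t *\<^sub>R b)) has_derivative (\<lambda>t. f' x (t *\<^sub>R b))) (at 0)"
      by (rule has_derivative_compose[of "\<lambda>t. x + t *\<^sub>R b" "\<lambda>t. t *\<^sub>R b", of _ _ f "f' x"])
        (use der[of x] in \<open>auto intro!: derivative_eq_intros\<close>)
    then have "((\<lambda>t. f (x + t *\<^sub>R b)) has_vector_derivative f' x b) (at 0)"
      using der[of x] by (simp add: has_vector_derivative_def linear_scale has_derivative_linear)
    then have "((\<lambda>t. norm (f (x + t *\<^sub>R b) - f x - t *\<^sub>R f' x b) / norm t) \<longlongrightarrow> 0) (at 0)"
      by (simp add: has_vector_derivative_def has_derivative_at)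
    moreover have "\<forall>\<^sub>F t in at 0. norm (f (x + t *\<^sub>R b) - f x - t *\<^sub>R f' x b) / norm t =
        norm ((f (x + t *\<^sub>R b) - f x) /\<^sub>R t - f' x b)"
    proof (rule eventually_at_topological[THEN iffD2], intro exI[of _ UNIV] conjI ballI impI)
      fix t :: real assume "t \<noteq> 0"
      then have "(f (x + t *\<^sub>R b) - f x) /\<^sub>R t - f' x b = (f (x + t *\<^sub>R b) - f x - t *\<^sub>R f' x b) /\<^sub>R t"
        by (simp add: scaleR_diff_right)
      then show "norm (f (x + t *\<^sub>R b) - f x - t *\<^sub>R f' x b) / norm t =
          norm ((f (x + t *\<^sub>R b) - f x) /\<^sub>R t - f' x b)"
        by (simp add: divide_inverse mult.commute)
    qed auto
    ultimately have "((\<lambda>t. norm ((f (x + t *\<^sub>R b) - f x) /\<^sub>R t - f' x b)) \<longlongrightarrow> 0) (at 0)"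
      by (rule Lim_transform_eventually)
    then have "((\<lambda>t. (f (x + t *\<^sub>R b) - f x) /\<^sub>R t) \<longlongrightarrow> f' x b) (at 0)"
      by (simp add: tendsto_norm_zero_iff LIM_zero_iff)
    moreover have "filterlim (\<lambda>n. 1 / real (Suc n)) (at 0) sequentially"
      using LIMSEQ_inverse_real_of_nat by (intro filterlim_atI) (auto simp: inverse_eq_divide)
    ultimately have "(\<lambda>n. (f (x + (1 / real (Suc n)) *\<^sub>R b) - f x) /\<^sub>R (1 / real (Suc n))) \<longlonglongrightarrow> f' x b"
      by (rule filterlim_compose)
    then show ?thesis by (simp add: q_def)
  qed
  have bound: "norm (q n x) \<le> indicator K' x * M" for n x
  proof (cases "x \<in> K'")
    case False
    have t: "1 / real (Suc n) \<in> {0..1}" by simp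
    have "x \<notin> K" using False image_eqI[of x "\<lambda>(x, t). x - t *\<^sub>R b" "(x, 0)"] by (auto simp: K'_def)
    moreover have "x + (1 / real (Suc n)) *\<^sub>R b \<notin> K"
      using False t image_eqI[of x "\<lambda>(x, t). x - t *\<^sub>R b" "(x + (1 / real (Suc n)) *\<^sub>R b, 1 / real (Suc n))"]
      by (auto simp: K'_def)
    ultimately show ?thesis using supp False by (simp add: q_def)
  next
    case True
    let ?t = "1 / real (Suc n)"
    have "norm (f (x + ?t *\<^sub>R b) - f (x + 0 *\<^sub>R b)) \<le> M * norm (?t - 0)"
    proof (rule differentiable_bound[where S = "{0..?t}"])
      fix s assume s: "s \<in> {0..?t}"
      show "((\<lambda>t. f (x + t *\<^sub>R b)) has_derivative (\<lambda>t. f' (x + s *\<^sub>R b) (t *\<^sub>R b))) (at s within {0..?t})"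
        by (rule has_derivative_compose[of "\<lambda>t. x + t *\<^sub>R b" "\<lambda>t. t *\<^sub>R b" s "{0..?t}" f "f' (x + s *\<^sub>R b)"])
          (use der in \<open>auto intro!: derivative_eq_intros\<close>)
      have "s \<in> {0..1}" using s by (auto intro: order_trans)
      then have "x + s *\<^sub>R b \<in> K''" using True by (force simp: K''_def)
      then have M': "norm (f' (x + s *\<^sub>R b) b) \<le> M" by (rule M)
      have "norm (f' (x + s *\<^sub>R b) (t *\<^sub>R b)) \<le> M * norm t" for t
      proof -
        have "norm (f' (x + s *\<^sub>R b) (t *\<^sub>R b)) = norm (f' (x + s *\<^sub>R b) b) * norm t"
          using der[of "x + s *\<^sub>R b"]
          by (simp add: linear_scale has_derivative_linear mult.commute)
        also have "\<dots> \<le> M * norm t" using M' by (rule mult_right_mono) simp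
        finally show ?thesis .
      qed
      then show "onorm (\<lambda>t. f' (x + s *\<^sub>R b) (t *\<^sub>R b)) \<le> M" by (rule onorm_le)
    qed auto
    then have "norm (f (x + ?t *\<^sub>R b) - f x) \<le> M * ?t" by simp
    then have "real (Suc n) * norm (f (x + ?t *\<^sub>R b) - f x) \<le> real (Suc n) * (M * ?t)"
      by (rule mult_left_mono) simp
    then show ?thesis using True by (simp add: q_def)
  qed
  have "(\<lambda>n. \<integral>x. q n x \<partial>lborel) \<longlonglongrightarrow> (\<integral>x. f' x b \<partial>lborel)"
  proof (rule integral_dominated_convergence[where w = "\<lambda>x. indicator K' x * M"])
    show "integrable lborel (\<lambda>x. indicator K' x * M)"
      using borel_integrable_compact[OF K'(1), of "\<lambda>_. M"] by simp
  qed (use lim bound cont qcont in \<open>auto intro!: borel_measurable_continuous_onI\<close>)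
  then have "(\<lambda>n. 0) \<longlonglongrightarrow> (\<integral>x. f' x b \<partial>lborel)" by (simp add: q0)
  then have "(\<integral>x. f' x b \<partial>lborel) = 0"
    using LIMSEQ_unique tendsto_const by blast
  moreover have "(\<lambda>x. f' x b) \<in> borel_measurable lborel"
    using cont by (auto intro!: borel_measurable_continuous_onI)
  ultimately show ?thesis by (simp add: integral_completion)
qed

text \<open>Integration by parts is the vanishing integral of the derivative of \<open>\<phi> * H\<close>. Since the support of \<open>\<phi>\<close>
is a compact subset of \<open>U\<close>, this product, extended by zero, is continuously differentiable on the whole
space.\<close>

lemma W11_loc_C1:
  fixes H :: "'a::euclidean_space \<Rightarrow> 'b::euclidean_space"
  assumes U: "open U" and der: "\<And>z. z \<in> U \<Longrightarrow> (H has_derivative D z) (at z)"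
    and cont: "\<And>b. b \<in> Basis \<Longrightarrow> continuous_on U (\<lambda>z. D z b)"
  shows "W11_loc U H D"
proof -
  have Hcont: "continuous_on U H"
    using der by (intro continuous_at_imp_continuous_on ballI has_derivative_continuous) auto
  have "(LINT z:U|lebesgue. frechet_derivative \<phi> (at z) b *\<^sub>R H z) =
      - (LINT z:U|lebesgue. \<phi> z *\<^sub>R D z b)"
    if b: "b \<in> Basis" and \<phi>: "test_function U \<phi>" for b :: 'a and \<phi>
  proof -
    define K where "K = closure {x. \<phi> x \<noteq> 0}"
    have K: "compact K" "K \<subseteq> U" using \<phi> by (auto simp: test_function_def K_def)
    have "C_k (Suc 0) \<phi>" using \<phi> by (simp add: test_function_def del: C_k.simps)
    then have d: "\<phi> differentiable_on UNIV"
      and dc: "continuous_on UNIV (\<lambda>x. frechet_derivative \<phi> (at x) b)"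
      using b by simp_all
    have \<phi>d: "(\<phi> has_derivative frechet_derivative \<phi> (at x)) (at x)" for x
      using d by (simp add: differentiable_on_def frechet_derivative_works)
    have \<phi>c: "continuous_on UNIV \<phi>"
      using d by (rule differentiable_imp_continuous_on)
    have \<phi>0: "\<phi> x = 0" if "x \<notin> K" for x
      using that closure_subset[of "{x. \<phi> x \<noteq> 0}"] by (auto simp: K_def)
    have oK: "open (- K)" using compact_imp_closed[OF K(1)] by (rule open_Compl)
    have d\<phi>0: "frechet_derivative \<phi> (at x) = (\<lambda>_. 0)" if "x \<notin> K" for x
    proof -
      have "((\<lambda>_. 0) has_derivative (\<lambda>_. 0)) (at x)" by simp
      then have "(\<phi> has_derivative (\<lambda>_. 0)) (at x)"
        by (rule has_derivative_transform_within_open[OF _ oK]) (use that \<phi>0 in auto)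
      then show ?thesis using frechet_derivative_at by metis
    qed
    define f where "f x = \<phi> x *\<^sub>R H x" for x
    define f' where "f' x w = frechet_derivative \<phi> (at x) w *\<^sub>R H x + \<phi> x *\<^sub>R (if x \<in> U then D x w else 0)" for x w
    have fK: "f x = 0" if "x \<notin> K" for x using \<phi>0[OF that] by (simp add: f_def)
    have f'K: "f' x w = 0" if "x \<notin> K" for x w using \<phi>0[OF that] d\<phi>0[OF that] by (simp add: f'_def)
    have "(f has_derivative f' x) (at x)" for x
    proof (cases "x \<in> U")
      case True
      have "((\<lambda>x. \<phi> x *\<^sub>R H x) has_derivative
          (\<lambda>w. \<phi> x *\<^sub>R D x w + frechet_derivative \<phi> (at x) w *\<^sub>R H x)) (at x)"
        by (intro has_derivative_scaleR \<phi>d der[OF True])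
      then show ?thesis using True by (simp add: f_def[abs_def] f'_def[abs_def] add.commute)
    next
      case False
      then have x: "x \<notin> K" using K by auto
      have "((\<lambda>_. 0) has_derivative (\<lambda>_. 0)) (at x)" by simp
      then have "(f has_derivative (\<lambda>_. 0)) (at x)"
        by (rule has_derivative_transform_within_open[OF _ oK]) (use x fK in auto)
      moreover have "f' x = (\<lambda>_. 0)" using f'K[OF x] by auto
      ultimately show ?thesis by simp
    qed
    moreover have "continuous_on UNIV (\<lambda>x. f' x b)"
    proof -
      have "continuous_on U (\<lambda>x. frechet_derivative \<phi> (at x) b *\<^sub>R H x + \<phi> x *\<^sub>R D x b)"
        by (intro continuous_intros Hcont cont b continuous_on_subset[OF dc] continuous_on_subset[OF \<phi>c]) auto
      then have "continuous_on U (\<lambda>x. f' x b)"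
        by (rule continuous_on_eq) (simp add: f'_def)
      moreover have "continuous_on (- K) (\<lambda>x. f' x b)"
        using continuous_on_const[of "- K" 0] by (rule continuous_on_eq) (simp add: f'K)
      ultimately have "continuous_on (U \<union> - K) (\<lambda>x. f' x b)"
        by (rule continuous_on_open_Un[OF U oK])
      moreover have "U \<union> - K = UNIV" using K by auto
      ultimately show ?thesis by simp
    qed
    ultimately have "(\<integral>x. f' x b \<partial>lebesgue) = 0"
      using integral_directional_derivative_zero[of f f' b K] K fK by blast
    define g1 where "g1 x = frechet_derivative \<phi> (at x) b *\<^sub>R H x" for x
    define g2 where "g2 x = \<phi> x *\<^sub>R D x b" for x
    have "continuous_on K g1" "continuous_on K g2"
      unfolding g1_def g2_def
      using continuous_on_subset[OF Hcont K(2)] continuous_on_subset[OF cont[OF b] K(2)]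
        continuous_on_subset[OF dc, of K] continuous_on_subset[OF \<phi>c, of K]
      by (auto intro!: continuous_intros)
    then have int: "set_integrable lebesgue K g1" "set_integrable lebesgue K g2"
      by (auto intro: set_integrable_continuous_compact K)
    have eq: "indicator U x *\<^sub>R g1 x = indicator K x *\<^sub>R g1 x"
      "indicator U x *\<^sub>R g2 x = indicator K x *\<^sub>R g2 x"
      "f' x b = indicator U x *\<^sub>R g1 x + indicator U x *\<^sub>R g2 x" for x
    proof -
      have "x \<notin> K" if "x \<notin> U" using that K(2) by auto
      then show "indicator U x *\<^sub>R g1 x = indicator K x *\<^sub>R g1 x"
        "indicator U x *\<^sub>R g2 x = indicator K x *\<^sub>R g2 x"
        "f' x b = indicator U x *\<^sub>R g1 x + indicator U x *\<^sub>R g2 x"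
        using K(2) \<phi>0[of x] d\<phi>0[of x]
        by (auto simp: g1_def g2_def f'_def indicator_def)
    qed
    have "(\<integral>x. f' x b \<partial>lebesgue) = (LINT x:U|lebesgue. g1 x) + (LINT x:U|lebesgue. g2 x)"
      unfolding set_lebesgue_integral_def eq
      using int unfolding set_integrable_def by (rule Bochner_Integration.integral_add)
    then show ?thesis
      using \<open>(\<integral>x. f' x b \<partial>lebesgue) = 0\<close> unfolding g1_def g2_def
      by (simp add: eq_neg_iff_add_eq_0)
  qed
  then show ?thesis
    unfolding W11_loc_def
    using der cont Hcont by (auto intro: L1_loc_continuous has_derivative_linear)
qed

context homeo_primitive
begin

lemma continuous_on_BA_differential:
  "continuous_on upper_half_plane (\<lambda>z. BA_differential z w)"
proof -
  have C: "(\<lambda>z. Complex (f z) (g z)) = (\<lambda>z. of_real (f z) + \<i> * of_real (g z))" for f g :: "complex \<Rightarrow> real"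
    by (simp add: Complex_eq)
  show ?thesis
    unfolding BA_differential_def right_incr_def left_incr_def right_gap_def left_gap_def mean_def C
    by (intro continuous_intros continuous_on_compose2[OF primitive_continuous] continuous_on_compose2[OF continuous])
      (auto simp: upper_half_plane_def)
qed

end

section \<open>Distortion, dilatation and BMO-quasiconformality\<close>

context homeo_primitive
begin

lemma finite_distortion_BA_extension:
  "finite_distortion upper_half_plane upper_half_plane (BA_extension h) BA_differential"
proof -
  have "continuous_on upper_half_plane (\<lambda>z. det_lin (BA_differential z))"
    unfolding det_lin_def by (intro continuous_intros continuous_on_BA_differential)
  moreover have "W11_loc upper_half_plane (BA_extension h) BA_differential"
  proof (rule W11_loc_C1[OF open_upper_half_plane])
    show "(BA_extension h has_derivative BA_differential z) (at z)" if "z \<in> upper_half_plane" for z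
      using that by (intro has_derivative_BA_extension) (simp add: upper_half_plane_def)
  qed (rule continuous_on_BA_differential)
  moreover have "AE z in lebesgue_on upper_half_plane. dilatation (BA_differential z) < \<infinity>"
    by (intro AE_I2 dilatation_finite) (simp add: upper_half_plane_def space_restrict_space)
  ultimately show ?thesis
    unfolding finite_distortion_def
    using open_upper_half_plane homeomorphism_BA_extension orientation_preserving_BA_extension
    by (blast intro: L1_loc_continuous)
qed

lemma BMO_quasiconformal_BA_extension:
  assumes "Q \<in> BMO upper_half_plane" "\<And>z. 0 < Im z \<Longrightarrow> BA_dilatation h z \<le> ereal (Q z)"
  shows "BMO_quasiconformal upper_half_plane upper_half_plane (BA_extension h)"
proof -
  have "AE z in lebesgue_on upper_half_plane. dilatation (BA_differential z) \<le> ereal (Q z)"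
  proof (rule AE_I2)
    fix z assume "z \<in> space (lebesgue_on upper_half_plane)"
    then have "0 < Im z" by (simp add: upper_half_plane_def space_restrict_space)
    then show "dilatation (BA_differential z) \<le> ereal (Q z)"
      using assms(2)[of z] by (simp add: BA_dilatation_def frechet_derivative_BA_extension)
  qed
  then show ?thesis
    unfolding BMO_quasiconformal_def using finite_distortion_BA_extension assms(1) by blast
qed

end

lemma BMO_norm_nonneg: "A \<in> BMO upper_half_plane \<Longrightarrow> 0 \<le> BMO_norm upper_half_plane A"
proof -
  assume A: "A \<in> BMO upper_half_plane"
  have "cball (2 * \<i>) 1 \<subseteq> upper_half_plane"
  proof
    fix w assume "w \<in> cball (2 * \<i>) 1"
    from in_cball_components(2)[OF this] show "w \<in> upper_half_plane"
      by (simp add: upper_half_plane_def)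
  qed
  then have "cball (2 * \<i>) 1 \<in> balls_in upper_half_plane" by (force simp: balls_in_def)
  moreover have "0 \<le> mean_osc (cball (2 * \<i>) 1) A"
    by (simp add: mean_osc_def avg_def set_lebesgue_integral_def)
  ultimately show ?thesis using mean_osc_le_norm[OF A] by fastforce
qed

text \<open>Discs and rectangles are treated alike, as cells of a shape \<open>S\<close>.\<close>

locale BA_whitney = homeo_primitive h F + whitney_shape S
  for h F :: "real \<Rightarrow> real" and S :: "complex set" +
  fixes A :: "complex \<Rightarrow> real"
  assumes BMO: "A \<in> BMO upper_half_plane"
begin

abbreviation "A_norm \<equiv> BMO_norm upper_half_plane A"

text \<open>The constant is \<open>32 * 204800\<close>. Distortions are at least 1, so the average at \<open>z\<close> is positive and its
coefficient 32 may be enlarged to this value.\<close>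

lemma dilatation_le_average:
  assumes \<rho>: "\<And>w. 0 < Im w \<Longrightarrow> sym_distortion h (Re w) (Im w) \<le> avg (cell w) A" and z: "0 < Im z"
  shows "BA_dilatation h z \<le> ereal (6553600 * avg (cell z) A + 6553600 * A_norm)"
proof -
  have "sym_distortion h (Re w) (Im w) \<le> avg (cell z) A + 204800 * A_norm"
    if w: "\<bar>Re w - Re z\<bar> \<le> Im z" "Im z / 2 \<le> Im w" "Im w \<le> Im z" for w
    using \<rho>[of w] cell_avg_slow[OF BMO z, of w] w z by (simp add: nearby_def)
  then have "BA_dilatation h z \<le> ereal (32 * (avg (cell z) A + 204800 * A_norm))"
    by (rule dilatation_le_sym_distortion[OF z])
  also have "\<dots> \<le> ereal (6553600 * avg (cell z) A + 6553600 * A_norm)"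
    using \<rho>[OF z] sym_distortion_ge_1[OF z] by simp
  finally show ?thesis .
qed

lemma sym_distortion_le_average:
  assumes K: "\<And>w. 0 < Im w \<Longrightarrow> BA_dilatation h w \<le> ereal (avg (cell w) A)" and z: "0 < Im z"
  shows "sym_distortion h (Re z) (Im z) \<le> 4 * avg (cell z) A"
proof -
  have "ereal (sym_distortion h (Re z) (Im z) / 2) \<le> ereal (avg (cell z) A)"
    using sym_distortion_le_dilatation[OF z] K[OF z] by (rule order_trans)
  then show ?thesis using sym_distortion_ge_1[OF z] by simp
qed

text \<open>Averages are slowly varying even though \<open>A\<close> itself need not be, and an affine function of a slowly
varying function is slowly varying.\<close>

lemma BMO_affine_average: "(\<lambda>z. c * avg (cell z) A + d) \<in> BMO upper_half_plane"
proof (rule BMO_slowly_varying)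
  show "continuous_on upper_half_plane (\<lambda>z. c * avg (cell z) A + d)"
    using BMO by (intro continuous_intros continuous_on_cell_avg) (simp add: BMO_def)
  show "\<bar>(c * avg (cell w) A + d) - (c * avg (cell z) A + d)\<bar> \<le> \<bar>c\<bar> * (204800 * A_norm)"
    if "0 < Im z" "nearby z w" for z w
    using mult_left_mono[OF cell_avg_slow[OF BMO that], of "\<bar>c\<bar>"]
    by (simp add: abs_mult[symmetric] right_diff_distrib)
qed

lemma BMO_quasiconformal_if_average:
  assumes "(\<forall>w\<in>upper_half_plane. sym_distortion h (Re w) (Im w) \<le> avg (cell w) A) \<or>
    (\<forall>w\<in>upper_half_plane. BA_dilatation h w \<le> ereal (avg (cell w) A))"
  shows "BMO_quasiconformal upper_half_plane upper_half_plane (BA_extension h)"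
  using assms
proof
  assume "\<forall>w\<in>upper_half_plane. sym_distortion h (Re w) (Im w) \<le> avg (cell w) A"
  then show ?thesis
    by (intro BMO_quasiconformal_BA_extension[OF BMO_affine_average[of 6553600 "6553600 * A_norm"]]
        dilatation_le_average)
      (simp_all add: upper_half_plane_def)
next
  assume "\<forall>w\<in>upper_half_plane. BA_dilatation h w \<le> ereal (avg (cell w) A)"
  then show ?thesis
    by (intro BMO_quasiconformal_BA_extension[OF BMO_affine_average[of 1 0]])
      (simp add: upper_half_plane_def)
qed

end

theorem theorem1p8:
  shows "\<exists>C::real. 0 < C \<and>
    (\<forall>(h :: real \<Rightarrow> real) (A :: complex \<Rightarrow> real).
      increasing_homeo h \<and> A \<in> BMO upper_half_plane \<longrightarrow>
        ((\<forall>z\<in>upper_half_plane. sym_distortion h (Re z) (Im z) \<le> avg_hat A z) \<longrightarrow>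
         (\<forall>z\<in>upper_half_plane.
            BA_dilatation h z \<le> ereal (C * avg_hat A z + C * BMO_norm upper_half_plane A))) \<and>
        ((\<forall>z\<in>upper_half_plane. BA_dilatation h z \<le> ereal (avg_hat A z)) \<longrightarrow>
         (\<forall>z\<in>upper_half_plane. sym_distortion h (Re z) (Im z) \<le> 4 * avg_hat A z)) \<and>
        ((\<forall>z\<in>upper_half_plane. sym_distortion h (Re z) (Im z) \<le> avg_check A z) \<longrightarrow>
         (\<forall>z\<in>upper_half_plane.
            BA_dilatation h z \<le> ereal (C * avg_check A z + C * BMO_norm upper_half_plane A))) \<and>
        ((\<forall>z\<in>upper_half_plane. BA_dilatation h z \<le> ereal (avg_check A z)) \<longrightarrow>
         (\<forall>z\<in>upper_half_plane. sym_distortion h (Re z) (Im z) \<le> 4 * avg_check A z)) \<and>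
        ((\<forall>z\<in>upper_half_plane. sym_distortion h (Re z) (Im z) \<le> avg_hat A z) \<or>
         (\<forall>z\<in>upper_half_plane. BA_dilatation h z \<le> ereal (avg_hat A z)) \<or>
         (\<forall>z\<in>upper_half_plane. sym_distortion h (Re z) (Im z) \<le> avg_check A z) \<or>
         (\<forall>z\<in>upper_half_plane. BA_dilatation h z \<le> ereal (avg_check A z)) \<longrightarrow>
         BMO_quasiconformal upper_half_plane upper_half_plane (BA_extension h)))"
proof (rule exI[of _ 6553600], rule conjI, simp, intro allI, rule impI, elim conjE)
  fix h :: "real \<Rightarrow> real" and A :: "complex \<Rightarrow> real"
  assume "increasing_homeo h" and A: "A \<in> BMO upper_half_plane"
  then obtain F where hF: "homeo_primitive h F" by (auto elim: increasing_homeo_primitive)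
  interpret hat: BA_whitney h F "ball \<i> (1/2)" A
    by (intro BA_whitney.intro BA_whitney_axioms.intro hF whitney_shape_ball A)
  interpret check: BA_whitney h F "box (Complex (-1) (1/2)) (Complex 1 (3/2))" A
    by (intro BA_whitney.intro BA_whitney_axioms.intro hF whitney_shape_box A)
  let ?U = upper_half_plane and ?N = "BMO_norm upper_half_plane A"
  have U: "z \<in> ?U \<longleftrightarrow> 0 < Im z" for z by (simp add: upper_half_plane_def)
  have hat:
    "(\<forall>z\<in>?U. sym_distortion h (Re z) (Im z) \<le> avg_hat A z) \<Longrightarrow>
      (\<forall>z\<in>?U. BA_dilatation h z \<le> ereal (6553600 * avg_hat A z + 6553600 * ?N))"
    "(\<forall>z\<in>?U. BA_dilatation h z \<le> ereal (avg_hat A z)) \<Longrightarrow>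
      (\<forall>z\<in>?U. sym_distortion h (Re z) (Im z) \<le> 4 * avg_hat A z)"
    "(\<forall>z\<in>?U. sym_distortion h (Re z) (Im z) \<le> avg_hat A z) \<or>
      (\<forall>z\<in>?U. BA_dilatation h z \<le> ereal (avg_hat A z)) \<Longrightarrow>
      BMO_quasiconformal ?U ?U (BA_extension h)"
    using hat.dilatation_le_average hat.sym_distortion_le_average hat.BMO_quasiconformal_if_average
    by (simp_all add: U avg_hat_cell)
  have check:
    "(\<forall>z\<in>?U. sym_distortion h (Re z) (Im z) \<le> avg_check A z) \<Longrightarrow>
      (\<forall>z\<in>?U. BA_dilatation h z \<le> ereal (6553600 * avg_check A z + 6553600 * ?N))"
    "(\<forall>z\<in>?U. BA_dilatation h z \<le> ereal (avg_check A z)) \<Longrightarrow>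
      (\<forall>z\<in>?U. sym_distortion h (Re z) (Im z) \<le> 4 * avg_check A z)"
    "(\<forall>z\<in>?U. sym_distortion h (Re z) (Im z) \<le> avg_check A z) \<or>
      (\<forall>z\<in>?U. BA_dilatation h z \<le> ereal (avg_check A z)) \<Longrightarrow>
      BMO_quasiconformal ?U ?U (BA_extension h)"
    using check.dilatation_le_average check.sym_distortion_le_average
      check.BMO_quasiconformal_if_average
    by (simp_all add: U avg_check_cell)
  show "((\<forall>z\<in>upper_half_plane. sym_distortion h (Re z) (Im z) \<le> avg_hat A z) \<longrightarrow>
         (\<forall>z\<in>upper_half_plane.
            BA_dilatation h z \<le> ereal (6553600 * avg_hat A z + 6553600 * BMO_norm upper_half_plane A))) \<and>
        ((\<forall>z\<in>upper_half_plane. BA_dilatation h z \<le> ereal (avg_hat A z)) \<longrightarrow>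
         (\<forall>z\<in>upper_half_plane. sym_distortion h (Re z) (Im z) \<le> 4 * avg_hat A z)) \<and>
        ((\<forall>z\<in>upper_half_plane. sym_distortion h (Re z) (Im z) \<le> avg_check A z) \<longrightarrow>
         (\<forall>z\<in>upper_half_plane.
            BA_dilatation h z \<le> ereal (6553600 * avg_check A z + 6553600 * BMO_norm upper_half_plane A))) \<and>
        ((\<forall>z\<in>upper_half_plane. BA_dilatation h z \<le> ereal (avg_check A z)) \<longrightarrow>
         (\<forall>z\<in>upper_half_plane. sym_distortion h (Re z) (Im z) \<le> 4 * avg_check A z)) \<and>
        ((\<forall>z\<in>upper_half_plane. sym_distortion h (Re z) (Im z) \<le> avg_hat A z) \<or>
         (\<forall>z\<in>upper_half_plane. BA_dilatation h z \<le> ereal (avg_hat A z)) \<or>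
         (\<forall>z\<in>upper_half_plane. sym_distortion h (Re z) (Im z) \<le> avg_check A z) \<or>
         (\<forall>z\<in>upper_half_plane. BA_dilatation h z \<le> ereal (avg_check A z)) \<longrightarrow>
         BMO_quasiconformal upper_half_plane upper_half_plane (BA_extension h))"
    using hat check by blast
qed

end
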